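(* Let $\mathcal{C}$ be an additive category with an automorphism $\Sigma$, let $n\ge3$, and let $\mathscr{N}$ be a collection of $n$-$\Sigma$-sequences in $\mathcal{C}$ satisfying the axioms (N1), (N2), (N3) and (N4). Then $\mathscr{N}$ also satisfies (N4* ).
   Context: $\mathcal{C}$ is an additive category, $\Sigma$ an automorphism of $\mathcal{C}$, $n\ge3$. An $n$-$\Sigma$-sequence is a diagram $A_1\xrightarrow{\alpha_1}A_2\to\cdots\xrightarrow{\alpha_{n-1}}A_n\xrightarrow{\alpha_n}\Sigma A_1$; its left rotation is $A_2\xrightarrow{\alpha_2}\cdots\xrightarrow{\alpha_n}\Sigma A_1\xrightarrow{(-1)^n\Sigma\alpha_1}\Sigma A_2$. A morphism $(\varphi_1,\dots,\varphi_n)\colon A_\bullet\to B_\bullet$ consists of $\varphi_i\colon A_i\to B_i$ with $\varphi_{i+1}\alpha_i=\beta_i\varphi_i$ ($1\le i\le n-1$) and $\Sigma\varphi_1\alpha_n=\beta_n\varphi_n$; isomorphisms have all $\varphi_i$ invertible. Direct sums are termwise; $A_\bullet$ is a direct summand of $B_\bullet$ if there are morphisms $\varphi\colon A_\bullet\to B_\bullet$, $\psi\colon B_\bullet\to A_\bullet$ with $\psi_i\varphi_i=1$. The mapping cone of $(\varphi_1,\dots,\varphi_n)$ is $A_2\oplus B_1\xrightarrow{\left[\begin{smallmatrix}-\alpha_2&0\\ \varphi_2&\beta_1\end{smallmatrix}\right]}A_3\oplus B_2\to\cdots\xrightarrow{\left[\begin{smallmatrix}-\alpha_n&0\\ \varphi_n&\beta_{n-1}\end{smallmatrix}\right]}\Sigma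 A_1\oplus B_n\xrightarrow{\left[\begin{smallmatrix}-\Sigma\alpha_1&0\\ \Sigma\varphi_1&\beta_n\end{smallmatrix}\right]}\Sigma A_2\oplus\Sigma B_1$ (the map $A_k\oplus B_{k-1}\to A_{k+1}\oplus B_k$ being $\left[\begin{smallmatrix}-\alpha_k&0\\ \varphi_k&\beta_{k-1}\end{smallmatrix}\right]$). Sequences in $\mathscr{N}$ are called $n$-angles. Axioms: (N1)(a) $\mathscr{N}$ is closed under direct sums, direct summands and isomorphisms; (b) $A\xrightarrow{1}A\to0\to\cdots\to0\to\Sigma A$ is in $\mathscr{N}$ for every $A$; (c) every morphism $A_1\to A_2$ is the first morphism of some sequence in $\mathscr{N}$. (N2) a sequence is in $\mathscr{N}$ iff its left rotation is. (N3) given $A_\bullet,B_\bullet\in\mathscr{N}$ and $\varphi_1,\varphi_2$ with $\varphi_2\alpha_1=\beta_1\varphi_1$, there exist $\varphi_3,\dots,\varphi_n$ making $(\varphi_1,\dots,\varphi_n)$ a morphism. (N4) in the situation of (N3), $\varphi_3,\dots,\varphi_n$ can be chosen so that the mapping cone is in $\mathscr{N}$. (N4* ): Suppose given $n$-angles $A_1\xrightarrow{\alpha_1}A_2\xrightarrow{\alpha_2}\cdots\xrightarrow{\alpha_n}\Sigma A_1$, $A_1\xrightarrow{\beta_1}B_2\xrightarrow{\beta_2}B_3\to\cdots\xrightarrow{\beta_n}\Sigma A_1$ and $A_2\xrightarrow{\varphi_2}B_2\xrightarrow{\gamma_2}C_3\xrightarrow{\gamma_3}\cdots\xrightarrow{\gamma_{n-1}}C_n\xrightarrow{\gamma_n}\Sigma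 A_2$ with $\varphi_2\alpha_1=\beta_1$. Then there exist morphisms $\varphi_i\colon A_i\to B_i$ ($3\le i\le n$) and $\psi_j$ ($1\le j\le 2n-5$) such that (1) $(1_{A_1},\varphi_2,\dots,\varphi_n)$ is a morphism of $n$-$\Sigma$-sequences; (2) $\gamma_n\circ\psi_{2n-5}=\Sigma\alpha_1\circ\beta_n$, and the following $n$-$\Sigma$-sequence $D_1\xrightarrow{d_1}D_2\to\cdots\to D_n\xrightarrow{d_n}\Sigma D_1$ is in $\mathscr{N}$. Set $A_i=B_i=C_i=0$ for $i>n$ and $C_i=0$ for $i\le2$; let $D_1=A_3$ and $D_{k+1}=A_{k+3}\oplus B_{k+2}\oplus C_{k+1}$ for $1\le k\le n-1$ (so $D_2=A_4\oplus B_3$, $D_n=C_n$); $d_1=\left[\begin{smallmatrix}\alpha_3\\ \varphi_3\end{smallmatrix}\right]$; for $1\le k\le n-2$, $d_{k+1}\colon D_{k+1}\to D_{k+2}$ is the matrix $\left[\begin{smallmatrix}-\alpha_{k+3}&0&0\\ (-1)^{k+1}\varphi_{k+3}&-\beta_{k+2}&0\\ \psi_{2k}&\psi_{2k-1}&\gamma_{k+1}\end{smallmatrix}\right]$ with the rows and columns belonging to zero summands deleted (so $d_2=\left[\begin{smallmatrix}-\alpha_4&0\\ \varphi_4&-\beta_3\\ \psi_2&\psi_1\end{smallmatrix}\right]$, $d_{n-1}=\left[\begin{smallmatrix}(-1)^n\varphi_n&-\beta_{n-1}&0\\ \psi_{2n-6}&\psi_{2n-7}&\gamma_{n-2}\end{smallmatrix}\right]$,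 and $d_{n-1}\colon B_n\oplus C_{n-1}\to C_n$ after it is $[\psi_{2n-5}\ \gamma_{n-1}]$ when indexed as $d_{n-1}$ for $k=n-2$); and $d_n=\Sigma\alpha_2\circ\gamma_n\colon C_n\to\Sigma A_3$. (For $n=3$ this sequence is $A_3\xrightarrow{\varphi_3}B_3\xrightarrow{\psi_1}C_3\xrightarrow{\Sigma\alpha_2\circ\gamma_3}\Sigma A_3$; for $n=4$ it is $A_3\xrightarrow{\left[\begin{smallmatrix}\alpha_3\\ \varphi_3\end{smallmatrix}\right]}A_4\oplus B_3\xrightarrow{\left[\begin{smallmatrix}\varphi_4&-\beta_3\\ \psi_2&\psi_1\end{smallmatrix}\right]}B_4\oplus C_3\xrightarrow{[\psi_3\ \gamma_3]}C_4\xrightarrow{\Sigma\alpha_2\circ\gamma_4}\Sigma A_3$.) *)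

theory Defs
  imports Main
begin

record ('o,'m) precat =
  Obj  :: "'o set"
  Arr  :: "'m set"
  src  :: "'m \<Rightarrow> 'o"
  tgt  :: "'m \<Rightarrow> 'o"
  cmp  :: "'m \<Rightarrow> 'm \<Rightarrow> 'm"   (* cmp C g f = g \<circ> f *)
  idm  :: "'o \<Rightarrow> 'm"
  addm :: "'m \<Rightarrow> 'm \<Rightarrow> 'm"
  negm :: "'m \<Rightarrow> 'm"
  zerm :: "'o \<Rightarrow> 'o \<Rightarrow> 'm"

definition Hom :: "('o,'m) precat \<Rightarrow> 'o \<Rightarrow> 'o \<Rightarrow> 'm set" where
  "Hom C X Y = {f \<in> Arr C. src C f = X \<and> tgt C f = Y}"

definition category :: "('o,'m) precat \<Rightarrow> bool" where
  "category C \<longleftrightarrow>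
     (\<forall>f\<in>Arr C. src C f \<in> Obj C \<and> tgt C f \<in> Obj C) \<and>
     (\<forall>X\<in>Obj C. idm C X \<in> Hom C X X) \<and>
     (\<forall>X\<in>Obj C. \<forall>Y\<in>Obj C. \<forall>Z\<in>Obj C. \<forall>f\<in>Hom C X Y. \<forall>g\<in>Hom C Y Z. cmp C g f \<in> Hom C X Z) \<and>
     (\<forall>f\<in>Arr C. cmp C f (idm C (src C f)) = f \<and> cmp C (idm C (tgt C f)) f = f) \<and>
     (\<forall>f\<in>Arr C. \<forall>g\<in>Arr C. \<forall>h\<in>Arr C. src C g = tgt C f \<longrightarrow> src C h = tgt C g \<longrightarrow>
        cmp C h (cmp C g f) = cmp C (cmp C h g) f)"

definition preadditive :: "('o,'m) precat \<Rightarrow> bool" where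
  "preadditive C \<longleftrightarrow> category C \<and>
     (\<forall>X\<in>Obj C. \<forall>Y\<in>Obj C.
        zerm C X Y \<in> Hom C X Y \<and>
        (\<forall>f\<in>Hom C X Y. \<forall>g\<in>Hom C X Y. addm C f g \<in> Hom C X Y \<and> addm C f g = addm C g f) \<and>
        (\<forall>f\<in>Hom C X Y. \<forall>g\<in>Hom C X Y. \<forall>h\<in>Hom C X Y.
            addm C (addm C f g) h = addm C f (addm C g h)) \<and>
        (\<forall>f\<in>Hom C X Y. addm C f (zerm C X Y) = f \<and> negm C f \<in> Hom C X Y \<and>
            addm C f (negm C f) = zerm C X Y)) \<and>
     (\<forall>X\<in>Obj C. \<forall>Y\<in>Obj C. \<forall>Z\<in>Obj C.
        (\<forall>f\<in>Hom C X Y. \<forall>g\<in>Hom C Y Z. \<forall>g'\<in>Hom C Y Z.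
            cmp C (addm C g g') f = addm C (cmp C g f) (cmp C g' f)) \<and>
        (\<forall>f\<in>Hom C X Y. \<forall>f'\<in>Hom C X Y. \<forall>g\<in>Hom C Y Z.
            cmp C g (addm C f f') = addm C (cmp C g f) (cmp C g f')))"

definition is_zero_obj :: "('o,'m) precat \<Rightarrow> 'o \<Rightarrow> bool" where
  "is_zero_obj C Z \<longleftrightarrow> Z \<in> Obj C \<and>
     (\<forall>X\<in>Obj C. (\<exists>!f. f \<in> Hom C Z X) \<and> (\<exists>!f. f \<in> Hom C X Z))"

definition msum :: "('o,'m) precat \<Rightarrow> 'o \<Rightarrow> 'o \<Rightarrow> 'm list \<Rightarrow> 'm" where
  "msum C X Y fs = foldr (addm C) fs (zerm C X Y)"

definition is_dsum :: "('o,'m) precat \<Rightarrow> nat \<Rightarrow> (nat \<Rightarrow> 'o) \<Rightarrow> 'o \<Rightarrow> (nat \<Rightarrow> 'm) \<Rightarrow> (nat \<Rightarrow> 'm) \<Rightarrow> bool" where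
  "is_dsum C m X P j q \<longleftrightarrow> P \<in> Obj C \<and>
     (\<forall>i\<in>{1..m}. j i \<in> Hom C (X i) P \<and> q i \<in> Hom C P (X i)) \<and>
     (\<forall>i\<in>{1..m}. \<forall>i'\<in>{1..m}.
         cmp C (q i) (j i') = (if i = i' then idm C (X i) else zerm C (X i') (X i))) \<and>
     msum C P P (map (\<lambda>i. cmp C (j i) (q i)) [1..<Suc m]) = idm C P"

definition two :: "'a \<Rightarrow> 'a \<Rightarrow> nat \<Rightarrow> 'a" where
  "two x y = (\<lambda>i. if i = 1 then x else y)"

definition three :: "'a \<Rightarrow> 'a \<Rightarrow> 'a \<Rightarrow> nat \<Rightarrow> 'a" where
  "three x y z = (\<lambda>i. if i = 1 then x else if i = 2 then y else z)"

definition additive_cat :: "('o,'m) precat \<Rightarrow> bool" where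
  "additive_cat C \<longleftrightarrow> preadditive C \<and> (\<exists>Z. is_zero_obj C Z) \<and>
     (\<forall>X\<in>Obj C. \<forall>Y\<in>Obj C. \<exists>P j q. is_dsum C 2 (two X Y) P j q)"

text \<open>A chosen zero object and chosen direct sums (any choice; all notions below
  are used only up to isomorphism, and the collection N is closed under isomorphism).\<close>
definition zob :: "('o,'m) precat \<Rightarrow> 'o" where
  "zob C = (SOME Z. is_zero_obj C Z)"

definition dsdata :: "('o,'m) precat \<Rightarrow> nat \<Rightarrow> (nat \<Rightarrow> 'o) \<Rightarrow> 'o \<times> (nat \<Rightarrow> 'm) \<times> (nat \<Rightarrow> 'm)" where
  "dsdata C m X = (SOME (P, j, q). is_dsum C m X P j q)"

text \<open>Matrix morphism between direct sums: j = injections of the target,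
  q = projections of the source, e r c = entry from source summand c to target summand r.\<close>
definition mat :: "('o,'m) precat \<Rightarrow> nat \<Rightarrow> 'o \<Rightarrow> 'o \<Rightarrow> (nat \<Rightarrow> 'm) \<Rightarrow> (nat \<Rightarrow> 'm)
                    \<Rightarrow> (nat \<Rightarrow> nat \<Rightarrow> 'm) \<Rightarrow> 'm" where
  "mat C m P Q j q e =
     msum C P Q [cmp C (j r) (cmp C (e r c) (q c)). r \<leftarrow> [1..<Suc m], c \<leftarrow> [1..<Suc m]]"

definition is_functor :: "('o,'m) precat \<Rightarrow> ('o,'m) precat \<Rightarrow> ('o \<Rightarrow> 'o) \<Rightarrow> ('m \<Rightarrow> 'm) \<Rightarrow> bool" where
  "is_functor C D F Fm \<longleftrightarrow>
     (\<forall>X\<in>Obj C. F X \<in> Obj D) \<and>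
     (\<forall>f\<in>Arr C. Fm f \<in> Hom D (F (src C f)) (F (tgt C f))) \<and>
     (\<forall>X\<in>Obj C. Fm (idm C X) = idm D (F X)) \<and>
     (\<forall>f\<in>Arr C. \<forall>g\<in>Arr C. src C g = tgt C f \<longrightarrow> Fm (cmp C g f) = cmp D (Fm g) (Fm f))"

text \<open>Automorphism: an endofunctor bijective on objects and on morphisms
  (its inverse is then automatically a functor).\<close>
definition automorphism :: "('o,'m) precat \<Rightarrow> ('o \<Rightarrow> 'o) \<Rightarrow> ('m \<Rightarrow> 'm) \<Rightarrow> bool" where
  "automorphism C S Sm \<longleftrightarrow> is_functor C C S Sm \<and>
     bij_betw S (Obj C) (Obj C) \<and> bij_betw Sm (Arr C) (Arr C)"

definition is_iso :: "('o,'m) precat \<Rightarrow> 'm \<Rightarrow> bool" where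
  "is_iso C f \<longleftrightarrow> f \<in> Arr C \<and> (\<exists>g\<in>Hom C (tgt C f) (src C f).
      cmp C g f = idm C (src C f) \<and> cmp C f g = idm C (tgt C f))"

definition sgnm :: "('o,'m) precat \<Rightarrow> nat \<Rightarrow> 'm \<Rightarrow> 'm" where
  "sgnm C k f = (if even k then f else negm C f)"

text \<open>An n-\<Sigma>-sequence A_1 \<rightarrow> ... \<rightarrow> A_n \<rightarrow> \<Sigma>A_1 is a pair (A, \<alpha>);
  only the indices 1..n are relevant.\<close>
type_synonym ('o,'m) seq = "(nat \<Rightarrow> 'o) \<times> (nat \<Rightarrow> 'm)"

definition is_seq :: "('o,'m) precat \<Rightarrow> ('o \<Rightarrow> 'o) \<Rightarrow> nat \<Rightarrow> ('o,'m) seq \<Rightarrow> bool" where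
  "is_seq C S n X \<longleftrightarrow> (let A = fst X; \<alpha> = snd X in
     (\<forall>i\<in>{1..n}. A i \<in> Obj C) \<and>
     (\<forall>i\<in>{1..<n}. \<alpha> i \<in> Hom C (A i) (A (Suc i))) \<and>
     \<alpha> n \<in> Hom C (A n) (S (A 1)))"

definition is_seqmor :: "('o,'m) precat \<Rightarrow> ('m \<Rightarrow> 'm) \<Rightarrow> nat \<Rightarrow> ('o,'m) seq \<Rightarrow> ('o,'m) seq
                          \<Rightarrow> (nat \<Rightarrow> 'm) \<Rightarrow> bool" where
  "is_seqmor C Sm n X Y \<phi> \<longleftrightarrow> (let A = fst X; \<alpha> = snd X; B = fst Y; \<beta> = snd Y in
     (\<forall>i\<in>{1..n}. \<phi> i \<in> Hom C (A i) (B i)) \<and>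
     (\<forall>i\<in>{1..<n}. cmp C (\<phi> (Suc i)) (\<alpha> i) = cmp C (\<beta> i) (\<phi> i)) \<and>
     cmp C (Sm (\<phi> 1)) (\<alpha> n) = cmp C (\<beta> n) (\<phi> n))"

definition is_seqiso :: "('o,'m) precat \<Rightarrow> ('m \<Rightarrow> 'm) \<Rightarrow> nat \<Rightarrow> ('o,'m) seq \<Rightarrow> ('o,'m) seq
                          \<Rightarrow> (nat \<Rightarrow> 'm) \<Rightarrow> bool" where
  "is_seqiso C Sm n X Y \<phi> \<longleftrightarrow> is_seqmor C Sm n X Y \<phi> \<and> (\<forall>i\<in>{1..n}. is_iso C (\<phi> i))"

definition is_seq_dsum :: "('o,'m) precat \<Rightarrow> ('m \<Rightarrow> 'm) \<Rightarrow> nat \<Rightarrow> ('o,'m) seq \<Rightarrow> ('o,'m) seq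
                           \<Rightarrow> ('o,'m) seq \<Rightarrow> bool" where
  "is_seq_dsum C Sm n X Y Z \<longleftrightarrow> (\<exists>iX iY pX pY.
     is_seqmor C Sm n X Z iX \<and> is_seqmor C Sm n Y Z iY \<and>
     is_seqmor C Sm n Z X pX \<and> is_seqmor C Sm n Z Y pY \<and>
     (\<forall>i\<in>{1..n}. is_dsum C 2 (two (fst X i) (fst Y i)) (fst Z i) (two (iX i) (iY i)) (two (pX i) (pY i))))"

definition rot :: "('o,'m) precat \<Rightarrow> ('o \<Rightarrow> 'o) \<Rightarrow> ('m \<Rightarrow> 'm) \<Rightarrow> nat \<Rightarrow> ('o,'m) seq \<Rightarrow> ('o,'m) seq" where
  "rot C S Sm n X = (let A = fst X; \<alpha> = snd X in
     (\<lambda>i. if i < n then A (Suc i) else S (A 1),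
      \<lambda>i. if i < n then \<alpha> (Suc i) else sgnm C n (Sm (\<alpha> 1))))"

definition triv_seq :: "('o,'m) precat \<Rightarrow> ('o \<Rightarrow> 'o) \<Rightarrow> nat \<Rightarrow> 'o \<Rightarrow> ('o,'m) seq" where
  "triv_seq C S n X = (let A = (\<lambda>i. if i \<le> 2 then X else zob C) in
     (A, \<lambda>i. if i = 1 then idm C X else zerm C (A i) (if i < n then A (Suc i) else S X)))"

definition cone :: "('o,'m) precat \<Rightarrow> ('o \<Rightarrow> 'o) \<Rightarrow> ('m \<Rightarrow> 'm) \<Rightarrow> nat \<Rightarrow> ('o,'m) seq \<Rightarrow> ('o,'m) seq
                    \<Rightarrow> (nat \<Rightarrow> 'm) \<Rightarrow> ('o,'m) seq" where
  "cone C S Sm n X Y \<phi> = (let A = fst X; \<alpha> = snd X; B = fst Y; \<beta> = snd Y;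
     A' = (\<lambda>k. if k < n then A (Suc k) else S (A 1));
     d = (\<lambda>k. dsdata C 2 (two (A' k) (B k)));
     P = (\<lambda>k. fst (d k)); J = (\<lambda>k. fst (snd (d k))); Q = (\<lambda>k. snd (snd (d k)))
   in (P, \<lambda>k. if k < n then
        mat C 2 (P k) (P (Suc k)) (J (Suc k)) (Q k)
          (\<lambda>r c. if r = 1 \<and> c = 1 then negm C (\<alpha> (Suc k))
                 else if r = 1 \<and> c = 2 then zerm C (B k) (A' (Suc k))
                 else if r = 2 \<and> c = 1 then \<phi> (Suc k)
                 else \<beta> k)
      else
        mat C 2 (P n) (S (P 1)) (\<lambda>r. Sm (J 1 r)) (Q n)
          (\<lambda>r c. if r = 1 \<and> c = 1 then negm C (Sm (\<alpha> 1))
                 else if r = 1 \<and> c = 2 then zerm C (B n) (S (A 2))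
                 else if r = 2 \<and> c = 1 then Sm (\<phi> 1)
                 else \<beta> n)))"

definition N1 :: "('o,'m) precat \<Rightarrow> ('o \<Rightarrow> 'o) \<Rightarrow> ('m \<Rightarrow> 'm) \<Rightarrow> nat \<Rightarrow> ('o,'m) seq set \<Rightarrow> bool" where
  "N1 C S Sm n N \<longleftrightarrow>
     \<comment> \<open>(a) closed under direct sums, direct summands and isomorphisms\<close>
     (\<forall>X\<in>N. \<forall>Y\<in>N. \<forall>Z. is_seq C S n Z \<longrightarrow> is_seq_dsum C Sm n X Y Z \<longrightarrow> Z \<in> N) \<and>
     (\<forall>X Y. is_seq C S n X \<longrightarrow> Y \<in> N \<longrightarrow>
        (\<exists>\<phi> \<psi>. is_seqmor C Sm n X Y \<phi> \<and> is_seqmor C Sm n Y X \<psi> \<and>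
               (\<forall>i\<in>{1..n}. cmp C (\<psi> i) (\<phi> i) = idm C (fst X i))) \<longrightarrow> X \<in> N) \<and>
     (\<forall>X Y. is_seq C S n X \<longrightarrow> Y \<in> N \<longrightarrow> (\<exists>\<phi>. is_seqiso C Sm n X Y \<phi>) \<longrightarrow> X \<in> N) \<and>
     \<comment> \<open>(b)\<close>
     (\<forall>X\<in>Obj C. triv_seq C S n X \<in> N) \<and>
     \<comment> \<open>(c)\<close>
     (\<forall>X\<in>Obj C. \<forall>Y\<in>Obj C. \<forall>f\<in>Hom C X Y.
        \<exists>Z\<in>N. fst Z 1 = X \<and> fst Z 2 = Y \<and> snd Z 1 = f)"

definition N2 :: "('o,'m) precat \<Rightarrow> ('o \<Rightarrow> 'o) \<Rightarrow> ('m \<Rightarrow> 'm) \<Rightarrow> nat \<Rightarrow> ('o,'m) seq set \<Rightarrow> bool" where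
  "N2 C S Sm n N \<longleftrightarrow> (\<forall>X. is_seq C S n X \<longrightarrow> (X \<in> N \<longleftrightarrow> rot C S Sm n X \<in> N))"

definition N3 :: "('o,'m) precat \<Rightarrow> ('o \<Rightarrow> 'o) \<Rightarrow> ('m \<Rightarrow> 'm) \<Rightarrow> nat \<Rightarrow> ('o,'m) seq set \<Rightarrow> bool" where
  "N3 C S Sm n N \<longleftrightarrow> (\<forall>X\<in>N. \<forall>Y\<in>N.
     \<forall>\<phi>1\<in>Hom C (fst X 1) (fst Y 1). \<forall>\<phi>2\<in>Hom C (fst X 2) (fst Y 2).
       cmp C \<phi>2 (snd X 1) = cmp C (snd Y 1) \<phi>1 \<longrightarrow>
       (\<exists>\<phi>. \<phi> 1 = \<phi>1 \<and> \<phi> 2 = \<phi>2 \<and> is_seqmor C Sm n X Y \<phi>))"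

definition N4 :: "('o,'m) precat \<Rightarrow> ('o \<Rightarrow> 'o) \<Rightarrow> ('m \<Rightarrow> 'm) \<Rightarrow> nat \<Rightarrow> ('o,'m) seq set \<Rightarrow> bool" where
  "N4 C S Sm n N \<longleftrightarrow> (\<forall>X\<in>N. \<forall>Y\<in>N.
     \<forall>\<phi>1\<in>Hom C (fst X 1) (fst Y 1). \<forall>\<phi>2\<in>Hom C (fst X 2) (fst Y 2).
       cmp C \<phi>2 (snd X 1) = cmp C (snd Y 1) \<phi>1 \<longrightarrow>
       (\<exists>\<phi>. \<phi> 1 = \<phi>1 \<and> \<phi> 2 = \<phi>2 \<and> is_seqmor C Sm n X Y \<phi> \<and> cone C S Sm n X Y \<phi> \<in> N))"

text \<open>The sequence D of (N4*), with zero summands realised by the chosen zero object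
  (isomorphic to the version with those summands deleted).
  X = (A,\<alpha>), Y = (B,\<beta>) with B 1 = A 1, Z = (C',\<gamma>) with C' 1 = A 2, C' 2 = B 2, \<gamma> 1 = \<phi>_2.\<close>
definition Dseq :: "('o,'m) precat \<Rightarrow> ('o \<Rightarrow> 'o) \<Rightarrow> ('m \<Rightarrow> 'm) \<Rightarrow> nat \<Rightarrow> ('o,'m) seq \<Rightarrow> ('o,'m) seq
                    \<Rightarrow> ('o,'m) seq \<Rightarrow> (nat \<Rightarrow> 'm) \<Rightarrow> (nat \<Rightarrow> 'm) \<Rightarrow> ('o,'m) seq" where
  "Dseq C S Sm n X Y Z \<phi> \<psi> = (let A = fst X; \<alpha> = snd X; B = fst Y; \<beta> = snd Y;
     Cc = fst Z; \<gamma> = snd Z; Z0 = zob C;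
     Ae = (\<lambda>i. if i \<le> n then A i else Z0);
     Be = (\<lambda>i. if i \<le> n then B i else Z0);
     Ce = (\<lambda>i. if 3 \<le> i \<and> i \<le> n then Cc i else Z0);
     obs = (\<lambda>k. three (Ae (k + 2)) (Be (k + 1)) (Ce k));   \<comment> \<open>summands of D_k, k \<ge> 2\<close>
     d = (\<lambda>k. dsdata C 3 (obs k));
     P = (\<lambda>k. fst (d k)); J = (\<lambda>k. fst (snd (d k))); Q = (\<lambda>k. snd (snd (d k)));
     \<comment> \<open>entries of d_{k+1} : D_{k+1} \<rightarrow> D_{k+2}, 1 \<le> k \<le> n-2\<close>
     ent = (\<lambda>k r c.
        if r = 1 \<and> c = 1 then (if k + 4 \<le> n then negm C (\<alpha> (k + 3)) else zerm C (Ae (k + 3)) (Ae (k + 4)))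
        else if r = 2 \<and> c = 1 then (if k + 3 \<le> n then sgnm C (k + 1) (\<phi> (k + 3)) else zerm C (Ae (k + 3)) (Be (k + 3)))
        else if r = 2 \<and> c = 2 then (if k + 3 \<le> n then negm C (\<beta> (k + 2)) else zerm C (Be (k + 2)) (Be (k + 3)))
        else if r = 3 \<and> c = 1 then (if k + 3 \<le> n then \<psi> (2 * k) else zerm C (Ae (k + 3)) (Ce (k + 2)))
        else if r = 3 \<and> c = 2 then \<psi> (2 * k - 1)
        else if r = 3 \<and> c = 3 then (if 2 \<le> k then \<gamma> (k + 1) else zerm C (Ce (k + 1)) (Ce (k + 2)))
        else zerm C (obs (k + 1) c) (obs (k + 2) r))
   in (\<lambda>k. if k = 1 then A 3 else P k,
       \<lambda>k. if k = 1 then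
             addm C (cmp C (J 2 1) (if 4 \<le> n then \<alpha> 3 else zerm C (A 3) (Ae 4)))
                    (cmp C (J 2 2) (\<phi> 3))
           else if k < n then mat C 3 (P k) (P (Suc k)) (J (Suc k)) (Q k) (ent (k - 1))
           else cmp C (Sm (\<alpha> 2)) (cmp C (\<gamma> n) (Q n 3))))"

definition N4star :: "('o,'m) precat \<Rightarrow> ('o \<Rightarrow> 'o) \<Rightarrow> ('m \<Rightarrow> 'm) \<Rightarrow> nat \<Rightarrow> ('o,'m) seq set \<Rightarrow> bool" where
  "N4star C S Sm n N \<longleftrightarrow> (\<forall>X\<in>N. \<forall>Y\<in>N. \<forall>Z\<in>N. \<forall>\<phi>2.
     fst Y 1 = fst X 1 \<and> fst Z 1 = fst X 2 \<and> fst Z 2 = fst Y 2 \<and> snd Z 1 = \<phi>2 \<and>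
     cmp C \<phi>2 (snd X 1) = snd Y 1 \<longrightarrow>
     (\<exists>\<phi> \<psi>. \<phi> 1 = idm C (fst X 1) \<and> \<phi> 2 = \<phi>2 \<and> is_seqmor C Sm n X Y \<phi> \<and>
        (\<forall>k\<in>{1..n-2}. \<psi> (2 * k - 1) \<in> Hom C (fst Y (k + 2)) (fst Z (k + 2)) \<and>
                       (k + 3 \<le> n \<longrightarrow> \<psi> (2 * k) \<in> Hom C (fst X (k + 3)) (fst Z (k + 2)))) \<and>
        cmp C (snd Z n) (\<psi> (2 * n - 5)) = cmp C (Sm (snd X 1)) (snd Y n) \<and>
        Dseq C S Sm n X Y Z \<phi> \<psi> \<in> N))"

end

theory Submission
  imports Defs
begin

text \<open>
  If \<open>\<phi>\<close> is a morphism of n-angles with first component an identity, then the mapping cone of \<open>\<phi>\<close>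
  has the "reduced cone" \<open>A\<^sub>2 \<rightarrow> A\<^sub>3 \<oplus> B\<^sub>2 \<rightarrow> \<dots> \<rightarrow> A\<^sub>n \<oplus> B\<^sub>n\<^sub>-\<^sub>1 \<rightarrow> B\<^sub>n \<rightarrow> \<Sigma>A\<^sub>2\<close> as a direct summand:
  the two copies of \<open>A\<^sub>1\<close> cancel because consecutive maps of an n-angle compose to zero.
  Apply this first to the morphism \<open>(1, \<phi>\<^sub>2, \<dots>)\<close> from A to B, giving an n-angle E, and then to a morphism
  \<open>\<theta>\<close> from E to C extending \<open>(1, [0 1])\<close>. In the resulting n-angle the two copies of \<open>B\<^sub>2\<close> cancel as well,
  and up to the sign \<open>(-1)\<^sup>k\<^sup>+\<^sup>1\<close> on the A-component what remains is the sequence D, where the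
  \<open>\<psi>\<close> are the components of \<open>\<theta>\<close>.
\<close>

text \<open>Each cancellation is a Gaussian elimination along an identity entry. In a cone of a
  morphism starting with an identity, the pivot is \<open>Sm (\<phi> 1)\<close> in the closing map,
  so it joins the last object to the shift of the first. In the second cone there is one more pivot,
  the B_2-entry of \<theta>_2 = [0 1], in the first map. No complement is split off and no
  isomorphism is built. The sign has its origin in the second cone, which negates the maps of E: the
  entries -\<alpha>, \<phi>, \<beta> become \<alpha>, -\<phi>, -\<beta>. Alternating the sign of the
  A-component turns \<alpha> back into -\<alpha>, leaves -\<beta> alone and gives \<phi> the
  alternating sign found in D. The same sign enters the even-indexed \<psi>, whose source is the
  A-component.

  The block above contains a malformed symbol. The IDEA block below replaces it.\<close>

declare One_nat_def [simp del]

section \<open>Calculus in an additive category\<close>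

locale additive_category =
  fixes C :: "('o,'m) precat"
  assumes additive: "additive_cat C"
begin


abbreviation comp (infixr \<open>\<cdot>\<close> 70) where "g \<cdot> f \<equiv> cmp C g f"
abbreviation plus (infixr \<open>\<boxplus>\<close> 65) where "f \<boxplus> g \<equiv> addm C f g"
abbreviation neg (\<open>\<boxminus> _\<close> [81] 80) where "\<boxminus> f \<equiv> negm C f"
abbreviation zero (\<open>\<zero>\<close>) where "\<zero> \<equiv> zerm C"
abbreviation hom where "hom \<equiv> Hom C"
abbreviation obj where "obj X \<equiv> X \<in> Obj C"
abbreviation arr where "arr f \<equiv> f \<in> Arr C"
abbreviation dom where "dom \<equiv> src C"
abbreviation cod where "cod \<equiv> tgt C"
abbreviation one where "one \<equiv> idm C"

section \<open>Laws of composition and addition\<close>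

lemma preadd: "preadditive C"
  using additive unfolding additive_cat_def by blast

lemma cat: "category C"
  using preadd unfolding preadditive_def by blast

text \<open>Source and target of a composite can be computed, whereas the objects in a hom-set
  membership would have to be guessed. The laws below are therefore restated with
  \<open>arr\<close>, \<open>dom\<close> and \<open>cod\<close>, and their side conditions become
  rewriting problems.\<close>

lemma hom_iff: "f \<in> hom X Y \<longleftrightarrow> arr f \<and> dom f = X \<and> cod f = Y"
  by (auto simp: Hom_def)

lemma obj_dom [simp]: "arr f \<Longrightarrow> obj (dom f)" and obj_cod [simp]: "arr f \<Longrightarrow> obj (cod f)"
  using cat by (auto simp: category_def)

lemma one_hom: "obj X \<Longrightarrow> one X \<in> hom X X"
  using cat by (auto simp: category_def)

lemma hom_obj: "f \<in> hom X Y \<Longrightarrow> obj X \<and> obj Y"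
  by (auto simp: hom_iff)

lemma comp_hom: "f \<in> hom X Y \<Longrightarrow> g \<in> hom Y Z \<Longrightarrow> g \<cdot> f \<in> hom X Z"
  using cat[unfolded category_def] hom_obj[of f X Y] hom_obj[of g Y Z] by blast

lemma zero_hom: "obj X \<Longrightarrow> obj Y \<Longrightarrow> \<zero> X Y \<in> hom X Y"
  using preadd[unfolded preadditive_def] by blast

lemma
  assumes f: "f \<in> hom X Y" and g: "g \<in> hom X Y"
  shows plus_hom: "f \<boxplus> g \<in> hom X Y"
    and neg_hom: "\<boxminus> f \<in> hom X Y"
    and plus_commute_hom: "f \<boxplus> g = g \<boxplus> f"
    and plus_assoc_hom: "h \<in> hom X Y \<Longrightarrow> (f \<boxplus> g) \<boxplus> h = f \<boxplus> g \<boxplus> h"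
    and plus_zero_hom: "f \<boxplus> \<zero> X Y = f"
    and plus_neg_hom: "f \<boxplus> \<boxminus> f = \<zero> X Y"
    and plus_comp_hom: "u \<in> hom W X \<Longrightarrow> (f \<boxplus> g) \<cdot> u = f \<cdot> u \<boxplus> g \<cdot> u"
    and comp_plus_hom: "v \<in> hom Y Z \<Longrightarrow> v \<cdot> (f \<boxplus> g) = v \<cdot> f \<boxplus> v \<cdot> g"
  using preadd[unfolded preadditive_def] f g hom_obj[OF f] hom_obj[of u W X] hom_obj[of v Y Z]
  by blast+

lemma one_simps [simp]: "obj X \<Longrightarrow> arr (one X)" "obj X \<Longrightarrow> dom (one X) = X" "obj X \<Longrightarrow> cod (one X) = X"
  using one_hom by (auto simp: hom_iff)

lemma zero_simps [simp]:
  "obj X \<Longrightarrow> obj Y \<Longrightarrow> arr (\<zero> X Y)" "obj X \<Longrightarrow> obj Y \<Longrightarrow> dom (\<zero> X Y) = X"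
  "obj X \<Longrightarrow> obj Y \<Longrightarrow> cod (\<zero> X Y) = Y"
  using zero_hom by (auto simp: hom_iff)

lemma comp_simps [simp]:
  assumes "arr f" "arr g" "dom g = cod f"
  shows "arr (g \<cdot> f)" "dom (g \<cdot> f) = dom f" "cod (g \<cdot> f) = cod g"
  using comp_hom[of f "dom f" "cod f" g "cod g"] assms by (auto simp: hom_iff)

lemma plus_simps [simp]:
  assumes "arr f" "arr g" "dom g = dom f" "cod g = cod f"
  shows "arr (f \<boxplus> g)" "dom (f \<boxplus> g) = dom f" "cod (f \<boxplus> g) = cod f"
  using plus_hom[of f "dom f" "cod f" g] assms by (auto simp: hom_iff)

lemma neg_simps [simp]:
  assumes "arr f"
  shows "arr (\<boxminus> f)" "dom (\<boxminus> f) = dom f" "cod (\<boxminus> f) = cod f"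
  using neg_hom[of f "dom f" "cod f" f] assms by (auto simp: hom_iff)

lemma comp_assoc [simp]:
  "arr f \<Longrightarrow> arr g \<Longrightarrow> arr h \<Longrightarrow> dom g = cod f \<Longrightarrow> dom h = cod g \<Longrightarrow> (h \<cdot> g) \<cdot> f = h \<cdot> g \<cdot> f"
  using cat by (simp add: category_def)

lemma comp_one [simp]: "arr f \<Longrightarrow> X = dom f \<Longrightarrow> f \<cdot> one X = f" "arr f \<Longrightarrow> X = cod f \<Longrightarrow> one X \<cdot> f = f"
  using cat by (auto simp: category_def)

lemma plus_commute: "arr f \<Longrightarrow> arr g \<Longrightarrow> dom g = dom f \<Longrightarrow> cod g = cod f \<Longrightarrow> f \<boxplus> g = g \<boxplus> f"
  by (rule plus_commute_hom[of f "dom f" "cod f"]) (simp_all add: hom_iff)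

lemma plus_assoc [simp]:
  "arr f \<Longrightarrow> arr g \<Longrightarrow> arr h \<Longrightarrow> dom g = dom f \<Longrightarrow> cod g = cod f \<Longrightarrow> dom h = dom f \<Longrightarrow> cod h = cod f
    \<Longrightarrow> (f \<boxplus> g) \<boxplus> h = f \<boxplus> g \<boxplus> h"
  by (rule plus_assoc_hom[of f "dom f" "cod f"]) (simp_all add: hom_iff)

lemma plus_left_commute:
  assumes "arr f" "arr g" "arr h" "dom g = dom f" "cod g = cod f" "dom h = dom f" "cod h = cod f"
  shows "f \<boxplus> g \<boxplus> h = g \<boxplus> f \<boxplus> h"
proof -
  have "f \<boxplus> g \<boxplus> h = (f \<boxplus> g) \<boxplus> h" using assms by simp
  also have "\<dots> = (g \<boxplus> f) \<boxplus> h" using assms by (simp only: plus_commute)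
  finally show ?thesis using assms by simp
qed

lemmas plus_ac = plus_commute plus_left_commute

lemma plus_zero [simp]: "arr f \<Longrightarrow> X = dom f \<Longrightarrow> Y = cod f \<Longrightarrow> f \<boxplus> \<zero> X Y = f"
  using plus_zero_hom[of f X Y f] by (simp add: hom_iff)

lemma zero_plus [simp]: "arr f \<Longrightarrow> X = dom f \<Longrightarrow> Y = cod f \<Longrightarrow> \<zero> X Y \<boxplus> f = f"
  using plus_commute[of f "\<zero> X Y"] by simp

lemma plus_neg [simp]: "arr f \<Longrightarrow> f \<boxplus> \<boxminus> f = \<zero> (dom f) (cod f)"
  using plus_neg_hom[of f "dom f" "cod f" f] by (simp add: hom_iff)

lemma neg_plus [simp]: "arr f \<Longrightarrow> \<boxminus> f \<boxplus> f = \<zero> (dom f) (cod f)"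
  using plus_commute[of f "\<boxminus> f"] by simp

lemma plus_neg_cancel [simp]:
  assumes "arr f" "arr g" "dom g = dom f" "cod g = cod f"
  shows "f \<boxplus> \<boxminus> f \<boxplus> g = g" "\<boxminus> f \<boxplus> f \<boxplus> g = g"
  using plus_assoc[of f "\<boxminus> f" g] plus_assoc[of "\<boxminus> f" f g] assms by simp_all

lemma plus_neg_cancel_left:
  assumes "arr f" "arr g" "arr h" "dom g = dom f" "cod g = cod f" "dom h = dom f" "cod h = cod f"
  shows "f \<boxplus> g \<boxplus> \<boxminus> f \<boxplus> h = g \<boxplus> h"
proof -
  have "f \<boxplus> g \<boxplus> \<boxminus> f \<boxplus> h = g \<boxplus> f \<boxplus> \<boxminus> f \<boxplus> h"
    by (rule plus_left_commute) (use assms in simp_all)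
  then show ?thesis using assms by simp
qed

lemma plus_cancel:
  assumes "arr f" "arr g" "arr h" "dom g = dom f" "cod g = cod f" "dom h = dom f" "cod h = cod f"
    "f \<boxplus> g = f \<boxplus> h"
  shows "g = h"
proof -
  have "g = \<boxminus> f \<boxplus> f \<boxplus> g" using assms(1-7) by simp
  also have "\<dots> = \<boxminus> f \<boxplus> f \<boxplus> h" unfolding assms(8) ..
  also have "\<dots> = h" using assms(1-7) by simp
  finally show ?thesis .
qed

lemma neg_unique:
  assumes "arr f" "arr g" "dom g = dom f" "cod g = cod f" "f \<boxplus> g = \<zero> (dom f) (cod f)"
  shows "g = \<boxminus> f"
  by (rule plus_cancel[of f]) (use assms in simp_all)

lemma neg_neg [simp]: "arr f \<Longrightarrow> \<boxminus> (\<boxminus> f) = f"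
  using neg_unique[of "\<boxminus> f" f] by simp

lemma neg_zero [simp]: "obj X \<Longrightarrow> obj Y \<Longrightarrow> \<boxminus> (\<zero> X Y) = \<zero> X Y"
  using neg_unique[of "\<zero> X Y" "\<zero> X Y"] by simp

lemma neg_distrib [simp]:
  assumes "arr f" "arr g" "dom g = dom f" "cod g = cod f"
  shows "\<boxminus> (f \<boxplus> g) = \<boxminus> f \<boxplus> \<boxminus> g"
proof -
  have "(f \<boxplus> g) \<boxplus> \<boxminus> f \<boxplus> \<boxminus> g = f \<boxplus> \<boxminus> f \<boxplus> g \<boxplus> \<boxminus> g"
    using assms plus_left_commute[of g "\<boxminus> f" "\<boxminus> g"] by simp
  then have "(f \<boxplus> g) \<boxplus> \<boxminus> f \<boxplus> \<boxminus> g = \<zero> (dom f) (cod f)" using assms by simp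
  with neg_unique[of "f \<boxplus> g" "\<boxminus> f \<boxplus> \<boxminus> g"] assms show ?thesis by simp
qed

lemma comp_plus [simp]:
  "arr f \<Longrightarrow> arr f' \<Longrightarrow> arr g \<Longrightarrow> dom f' = dom f \<Longrightarrow> cod f' = cod f \<Longrightarrow> dom g = cod f
    \<Longrightarrow> g \<cdot> (f \<boxplus> f') = g \<cdot> f \<boxplus> g \<cdot> f'"
  by (rule comp_plus_hom[of f "dom f" "cod f" f' g "cod g"]) (simp_all add: hom_iff)

lemma plus_comp [simp]:
  "arr f \<Longrightarrow> arr g \<Longrightarrow> arr g' \<Longrightarrow> dom g' = dom g \<Longrightarrow> cod g' = cod g \<Longrightarrow> dom g = cod f
    \<Longrightarrow> (g \<boxplus> g') \<cdot> f = g \<cdot> f \<boxplus> g' \<cdot> f"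
  by (rule plus_comp_hom[of g "dom g" "cod g" g' f "dom f"]) (simp_all add: hom_iff)

lemma idem_zero:
  assumes "arr f" "f \<boxplus> f = f" shows "f = \<zero> (dom f) (cod f)"
  by (rule plus_cancel[of f]) (use assms in simp_all)

lemma comp_zero [simp]:
  assumes "arr g" "obj X" "Y = dom g" shows "g \<cdot> \<zero> X Y = \<zero> X (cod g)"
proof -
  have "g \<cdot> \<zero> X Y \<boxplus> g \<cdot> \<zero> X Y = g \<cdot> (\<zero> X Y \<boxplus> \<zero> X Y)"
    by (rule comp_plus[symmetric]) (use assms in simp_all)
  also have "\<zero> X Y \<boxplus> \<zero> X Y = \<zero> X Y" using assms by simp
  finally show ?thesis using idem_zero[of "g \<cdot> \<zero> X Y"] assms by simp
qed

lemma zero_comp [simp]: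
  assumes "arr f" "obj Y" "X = cod f" shows "\<zero> X Y \<cdot> f = \<zero> (dom f) Y"
proof -
  have "\<zero> X Y \<cdot> f \<boxplus> \<zero> X Y \<cdot> f = (\<zero> X Y \<boxplus> \<zero> X Y) \<cdot> f"
    by (rule plus_comp[symmetric]) (use assms in simp_all)
  also have "\<zero> X Y \<boxplus> \<zero> X Y = \<zero> X Y" using assms by simp
  finally show ?thesis using idem_zero[of "\<zero> X Y \<cdot> f"] assms by simp
qed

lemma comp_neg [simp]:
  assumes "arr f" "arr g" "dom g = cod f" shows "g \<cdot> \<boxminus> f = \<boxminus> (g \<cdot> f)"
proof (rule neg_unique)
  have "g \<cdot> f \<boxplus> g \<cdot> \<boxminus> f = g \<cdot> (f \<boxplus> \<boxminus> f)"
    by (rule comp_plus[symmetric]) (use assms in simp_all)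
  then show "g \<cdot> f \<boxplus> g \<cdot> \<boxminus> f = \<zero> (dom (g \<cdot> f)) (cod (g \<cdot> f))"
    using assms by simp
qed (use assms in simp_all)

lemma neg_comp [simp]:
  assumes "arr f" "arr g" "dom g = cod f" shows "\<boxminus> g \<cdot> f = \<boxminus> (g \<cdot> f)"
proof (rule neg_unique)
  have "g \<cdot> f \<boxplus> \<boxminus> g \<cdot> f = (g \<boxplus> \<boxminus> g) \<cdot> f"
    by (rule plus_comp[symmetric]) (use assms in simp_all)
  then show "g \<cdot> f \<boxplus> \<boxminus> g \<cdot> f = \<zero> (dom (g \<cdot> f)) (cod (g \<cdot> f))"
    using assms by simp
qed (use assms in simp_all)

lemma sgnm_simps [simp]:
  assumes "arr f"
  shows "arr (sgnm C k f)" "dom (sgnm C k f) = dom f" "cod (sgnm C k f) = cod f"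
  using assms by (auto simp: sgnm_def)

section \<open>Zero objects\<close>

lemma is_zero_obj_zob: "is_zero_obj C (zob C)"
  unfolding zob_def by (rule someI_ex) (use additive in \<open>simp add: additive_cat_def\<close>)

lemma obj_zob [simp]: "obj (zob C)"
  using is_zero_obj_zob by (simp add: is_zero_obj_def)

lemma to_zero_obj:
  assumes "is_zero_obj C Z" "u \<in> hom X Z" shows "u = \<zero> X Z"
proof -
  have "\<exists>!f. f \<in> hom X Z" using assms hom_obj[OF assms(2)] by (simp add: is_zero_obj_def)
  then show ?thesis using assms(2) zero_hom hom_obj[OF assms(2)] by blast
qed

lemma from_zero_obj:
  assumes "is_zero_obj C Z" "u \<in> hom Z X" shows "u = \<zero> Z X"
proof -
  have "\<exists>!f. f \<in> hom Z X" using assms hom_obj[OF assms(2)] by (simp add: is_zero_obj_def)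
  then show ?thesis using assms(2) zero_hom hom_obj[OF assms(2)] by blast
qed

lemma zero_objI:
  assumes "obj Z" "one Z = \<zero> Z Z" shows "is_zero_obj C Z"
  unfolding is_zero_obj_def
proof (intro conjI ballI)
  fix X assume "obj X"
  show "\<exists>!f. f \<in> hom Z X"
  proof (rule ex1I[of _ "\<zero> Z X"])
    fix f assume "f \<in> hom Z X"
    then have f: "arr f" "dom f = Z" "cod f = X" by (simp_all add: hom_iff)
    have "f = f \<cdot> one Z" using f by simp
    also have "\<dots> = \<zero> Z X" unfolding assms(2) using f assms(1) by simp
    finally show "f = \<zero> Z X" .
  qed (use assms zero_hom \<open>obj X\<close> in simp)
  show "\<exists>!f. f \<in> hom X Z"
  proof (rule ex1I[of _ "\<zero> X Z"])
    fix f assume "f \<in> hom X Z"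
    then have f: "arr f" "dom f = X" "cod f = Z" by (simp_all add: hom_iff)
    have "f = one Z \<cdot> f" using f by simp
    also have "\<dots> = \<zero> X Z" unfolding assms(2) using f assms(1) by simp
    finally show "f = \<zero> X Z" .
  qed (use assms zero_hom \<open>obj X\<close> in simp)
qed (rule assms)

section \<open>Chosen binary direct sums\<close>

definition dsum where "dsum X Y = fst (dsdata C 2 (two X Y))"
definition in1 where "in1 X Y = fst (snd (dsdata C 2 (two X Y))) 1"
definition in2 where "in2 X Y = fst (snd (dsdata C 2 (two X Y))) 2"
definition pr1 where "pr1 X Y = snd (snd (dsdata C 2 (two X Y))) 1"
definition pr2 where "pr2 X Y = snd (snd (dsdata C 2 (two X Y))) 2"

lemma is_dsum_dsdata:
  assumes "\<exists>P j q. is_dsum C m X P j q"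
  shows "is_dsum C m X (fst (dsdata C m X)) (fst (snd (dsdata C m X))) (snd (snd (dsdata C m X)))"
proof -
  obtain P j q where "is_dsum C m X P j q" using assms by blast
  then have "case (P, j, q) of (P, j, q) \<Rightarrow> is_dsum C m X P j q" by simp
  then have "case dsdata C m X of (P, j, q) \<Rightarrow> is_dsum C m X P j q"
    unfolding dsdata_def by (rule someI)
  then show ?thesis by (simp add: case_prod_beta)
qed

lemma is_dsum_2_iff:
  "is_dsum C 2 X P j q \<longleftrightarrow> obj P \<and> j 1 \<in> hom (X 1) P \<and> j 2 \<in> hom (X 2) P
    \<and> q 1 \<in> hom P (X 1) \<and> q 2 \<in> hom P (X 2)
    \<and> q 1 \<cdot> j 1 = one (X 1) \<and> q 2 \<cdot> j 2 = one (X 2)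
    \<and> q 1 \<cdot> j 2 = \<zero> (X 2) (X 1) \<and> q 2 \<cdot> j 1 = \<zero> (X 1) (X 2)
    \<and> j 1 \<cdot> q 1 \<boxplus> j 2 \<cdot> q 2 = one P"
proof -
  have "{1..2} = {1,2::nat}" by auto
  moreover have "[1..<Suc 2] = [1,2]" by (simp add: upt_rec)
  moreover have "j 2 \<cdot> q 2 \<boxplus> \<zero> P P = j 2 \<cdot> q 2" if "j 2 \<in> hom (X 2) P" "q 2 \<in> hom P (X 2)"
    using that by (simp add: hom_iff)
  ultimately show ?thesis unfolding is_dsum_def msum_def by auto
qed

lemma is_dsum_3_iff:
  "is_dsum C 3 X P j q \<longleftrightarrow> obj P \<and> j 1 \<in> hom (X 1) P \<and> j 2 \<in> hom (X 2) P \<and> j 3 \<in> hom (X 3) P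
    \<and> q 1 \<in> hom P (X 1) \<and> q 2 \<in> hom P (X 2) \<and> q 3 \<in> hom P (X 3)
    \<and> q 1 \<cdot> j 1 = one (X 1) \<and> q 2 \<cdot> j 2 = one (X 2) \<and> q 3 \<cdot> j 3 = one (X 3)
    \<and> q 1 \<cdot> j 2 = \<zero> (X 2) (X 1) \<and> q 1 \<cdot> j 3 = \<zero> (X 3) (X 1)
    \<and> q 2 \<cdot> j 1 = \<zero> (X 1) (X 2) \<and> q 2 \<cdot> j 3 = \<zero> (X 3) (X 2)
    \<and> q 3 \<cdot> j 1 = \<zero> (X 1) (X 3) \<and> q 3 \<cdot> j 2 = \<zero> (X 2) (X 3)
    \<and> j 1 \<cdot> q 1 \<boxplus> j 2 \<cdot> q 2 \<boxplus> j 3 \<cdot> q 3 = one P"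
proof -
  have "{1..3} = {1,2,3::nat}" by auto
  moreover have "[1..<Suc 3] = [1,2,3]" by (simp add: upt_rec)
  moreover have "j 3 \<cdot> q 3 \<boxplus> \<zero> P P = j 3 \<cdot> q 3" if "j 3 \<in> hom (X 3) P" "q 3 \<in> hom P (X 3)"
    using that by (simp add: hom_iff)
  ultimately show ?thesis unfolding is_dsum_def msum_def by auto
qed

lemma is_dsum_dsum:
  assumes "obj X" "obj Y"
  shows "is_dsum C 2 (two X Y) (dsum X Y)
    (fst (snd (dsdata C 2 (two X Y)))) (snd (snd (dsdata C 2 (two X Y))))"
  unfolding dsum_def using assms additive
  by (intro is_dsum_dsdata) (simp add: additive_cat_def)

lemma dsum_simps [simp]:
  assumes "obj X" "obj Y"
  shows "obj (dsum X Y)"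
    "arr (in1 X Y)" "dom (in1 X Y) = X" "cod (in1 X Y) = dsum X Y"
    "arr (in2 X Y)" "dom (in2 X Y) = Y" "cod (in2 X Y) = dsum X Y"
    "arr (pr1 X Y)" "dom (pr1 X Y) = dsum X Y" "cod (pr1 X Y) = X"
    "arr (pr2 X Y)" "dom (pr2 X Y) = dsum X Y" "cod (pr2 X Y) = Y"
    "pr1 X Y \<cdot> in1 X Y = one X" "pr2 X Y \<cdot> in2 X Y = one Y"
    "pr1 X Y \<cdot> in2 X Y = \<zero> Y X" "pr2 X Y \<cdot> in1 X Y = \<zero> X Y"
  using is_dsum_dsum[OF assms]
  unfolding is_dsum_2_iff in1_def in2_def pr1_def pr2_def hom_iff
  by (simp_all add: two_def)

lemma in_pr: "obj X \<Longrightarrow> obj Y \<Longrightarrow> in1 X Y \<cdot> pr1 X Y \<boxplus> in2 X Y \<cdot> pr2 X Y = one (dsum X Y)"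
  using is_dsum_dsum[of X Y] unfolding is_dsum_2_iff in1_def in2_def pr1_def pr2_def by simp

lemma dsum_comp_simps [simp]:
  assumes "obj X" "obj Y"
  shows "arr u \<Longrightarrow> cod u = X \<Longrightarrow> pr1 X Y \<cdot> in1 X Y \<cdot> u = u"
    "arr u \<Longrightarrow> cod u = Y \<Longrightarrow> pr2 X Y \<cdot> in2 X Y \<cdot> u = u"
    "arr u \<Longrightarrow> cod u = Y \<Longrightarrow> pr1 X Y \<cdot> in2 X Y \<cdot> u = \<zero> (dom u) X"
    "arr u \<Longrightarrow> cod u = X \<Longrightarrow> pr2 X Y \<cdot> in1 X Y \<cdot> u = \<zero> (dom u) Y"
  using assms comp_assoc[of u "in1 X Y" "pr1 X Y"] comp_assoc[of u "in2 X Y" "pr1 X Y"]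
    comp_assoc[of u "in1 X Y" "pr2 X Y"] comp_assoc[of u "in2 X Y" "pr2 X Y"]
  by (simp_all del: comp_assoc)

text \<open>Composing with \<open>in1 \<cdot> pr1 \<boxplus> in2 \<cdot> pr2\<close>, which is 1,
  recovers a map from its two coordinates. Most matrix identities below are checked row by row
  through this rule.\<close>

lemma dsum_ext:
  assumes "obj X" "obj Y" "u \<in> hom W (dsum X Y)" "v \<in> hom W (dsum X Y)"
    "pr1 X Y \<cdot> u = pr1 X Y \<cdot> v" "pr2 X Y \<cdot> u = pr2 X Y \<cdot> v"
  shows "u = v"
proof -
  have w: "w = in1 X Y \<cdot> pr1 X Y \<cdot> w \<boxplus> in2 X Y \<cdot> pr2 X Y \<cdot> w" if "w \<in> hom W (dsum X Y)" for w
  proof -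
    have "w = (in1 X Y \<cdot> pr1 X Y \<boxplus> in2 X Y \<cdot> pr2 X Y) \<cdot> w"
      unfolding in_pr[OF assms(1,2)] using that by (simp add: hom_iff)
    also have "\<dots> = in1 X Y \<cdot> pr1 X Y \<cdot> w \<boxplus> in2 X Y \<cdot> pr2 X Y \<cdot> w"
      using that assms(1,2) by (simp add: hom_iff)
    finally show ?thesis .
  qed
  show ?thesis by (subst w[OF assms(3)], subst w[OF assms(4)]) (simp only: assms(5,6))
qed

lemma dsum_zero:
  assumes X: "is_zero_obj C X" and Y: "is_zero_obj C Y"
  shows "is_zero_obj C (dsum X Y)"
proof -
  have [simp]: "obj X" "obj Y" using X Y by (simp_all add: is_zero_obj_def)
  have "pr1 X Y = \<zero> (dsum X Y) X" "pr2 X Y = \<zero> (dsum X Y) Y"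
    using to_zero_obj[OF X, of "pr1 X Y" "dsum X Y"] to_zero_obj[OF Y, of "pr2 X Y" "dsum X Y"]
    by (simp_all add: hom_iff)
  then have "one (dsum X Y) = \<zero> (dsum X Y) (dsum X Y)"
    by (intro dsum_ext[of X Y "one (dsum X Y)" "dsum X Y"]) (simp_all add: hom_iff)
  then show ?thesis by (intro zero_objI) simp_all
qed

section \<open>Direct sums of three objects\<close>

lemma ex_dsum_3:
  assumes "obj X" "obj Y" "obj Z"
  shows "\<exists>P j q. is_dsum C 3 (three X Y Z) P j q"
proof -
  let ?P = "dsum X (dsum Y Z)"
  let ?j = "three (in1 X (dsum Y Z)) (in2 X (dsum Y Z) \<cdot> in1 Y Z) (in2 X (dsum Y Z) \<cdot> in2 Y Z)"
  let ?q = "three (pr1 X (dsum Y Z)) (pr1 Y Z \<cdot> pr2 X (dsum Y Z)) (pr2 Y Z \<cdot> pr2 X (dsum Y Z))"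
  have "in2 X (dsum Y Z) \<cdot> in1 Y Z \<cdot> pr1 Y Z \<cdot> pr2 X (dsum Y Z)
      \<boxplus> in2 X (dsum Y Z) \<cdot> in2 Y Z \<cdot> pr2 Y Z \<cdot> pr2 X (dsum Y Z)
      = in2 X (dsum Y Z) \<cdot> (in1 Y Z \<cdot> pr1 Y Z \<boxplus> in2 Y Z \<cdot> pr2 Y Z) \<cdot> pr2 X (dsum Y Z)"
    using assms by simp
  then have "is_dsum C 3 (three X Y Z) ?P ?j ?q"
    using assms by (simp add: is_dsum_3_iff three_def hom_iff in_pr)
  then show ?thesis by blast
qed

lemma dsum_3_ext:
  assumes P: "is_dsum C 3 X P j q" and "u \<in> hom W P" "v \<in> hom W P"
    "q 1 \<cdot> u = q 1 \<cdot> v" "q 2 \<cdot> u = q 2 \<cdot> v" "q 3 \<cdot> u = q 3 \<cdot> v"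
  shows "u = v"
proof -
  have sum: "j 1 \<cdot> q 1 \<boxplus> j 2 \<cdot> q 2 \<boxplus> j 3 \<cdot> q 3 = one P"
    and hom: "arr (j 1)" "arr (j 2)" "arr (j 3)" "arr (q 1)" "arr (q 2)" "arr (q 3)"
      "dom (j 1) = cod (q 1)" "dom (j 2) = cod (q 2)" "dom (j 3) = cod (q 3)"
      "cod (j 1) = P" "cod (j 2) = P" "cod (j 3) = P" "dom (q 1) = P" "dom (q 2) = P" "dom (q 3) = P"
    using P by (simp_all add: is_dsum_3_iff hom_iff)
  have w: "w = j 1 \<cdot> q 1 \<cdot> w \<boxplus> j 2 \<cdot> q 2 \<cdot> w \<boxplus> j 3 \<cdot> q 3 \<cdot> w" if "w \<in> hom W P" for w
  proof -
    have "w = (j 1 \<cdot> q 1 \<boxplus> j 2 \<cdot> q 2 \<boxplus> j 3 \<cdot> q 3) \<cdot> w"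
      unfolding sum using that by (simp add: hom_iff)
    also have "\<dots> = j 1 \<cdot> q 1 \<cdot> w \<boxplus> j 2 \<cdot> q 2 \<cdot> w \<boxplus> j 3 \<cdot> q 3 \<cdot> w"
      using that hom by (simp add: hom_iff)
    finally show ?thesis .
  qed
  show ?thesis by (subst w[OF assms(2)], subst w[OF assms(3)]) (simp only: assms(4-6))
qed

text \<open>Composites are kept nested to the right, so an equation for \<open>q \<cdot> d\<close>
  does not match inside \<open>q \<cdot> d \<cdot> u\<close>. This version carries the tail
  \<open>u\<close>.\<close>

lemma comp_reduce:
  assumes "q \<cdot> d = g" "arr q" "arr d" "arr u" "dom q = cod d" "dom d = cod u"
  shows "q \<cdot> d \<cdot> u = g \<cdot> u"
  using comp_assoc[of u d q] assms by simp

lemma comp_cancel: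
  assumes "arr j" "arr q" "arr u" "dom q = cod j" "dom j = cod u"
  shows "q \<cdot> j = one (cod u) \<Longrightarrow> q \<cdot> j \<cdot> u = u"
    "q \<cdot> j = \<zero> (cod u) Y \<Longrightarrow> obj Y \<Longrightarrow> q \<cdot> j \<cdot> u = \<zero> (dom u) Y"
  using comp_assoc[of u j q] assms by (simp_all del: comp_assoc)

section \<open>Matrices and their rows\<close>

lemma msum_hom: "obj X \<Longrightarrow> obj Y \<Longrightarrow> set fs \<subseteq> hom X Y \<Longrightarrow> msum C X Y fs \<in> hom X Y"
  by (induction fs) (simp_all add: msum_def zero_hom plus_hom)

lemma comp_msum:
  assumes "obj X" "v \<in> hom Y Z" "set fs \<subseteq> hom X Y"
  shows "v \<cdot> msum C X Y fs = msum C X Z (map (cmp C v) fs)"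
  using assms(3)
proof (induction fs)
  case Nil
  then show ?case using assms(1,2) by (simp add: msum_def hom_iff)
next
  case (Cons f fs)
  have "msum C X Y fs \<in> hom X Y" using Cons.prems assms(1) hom_obj[OF assms(2)] by (simp add: msum_hom)
  then have "v \<cdot> (f \<boxplus> msum C X Y fs) = v \<cdot> f \<boxplus> v \<cdot> msum C X Y fs"
    using Cons.prems assms(2) by (intro comp_plus_hom) auto
  then show ?case using Cons by (simp add: msum_def)
qed

text \<open>The sums are arbitrary rather than the chosen ones, because the closing map of a cone
  ends in the shift of a chosen sum.\<close>

lemma mat_2:
  assumes P: "is_dsum C 2 X P j q" and P': "is_dsum C 2 X' P' j' q'"
    and e: "e 1 1 \<in> hom (X 1) (X' 1)" "e 1 2 \<in> hom (X 2) (X' 1)"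
      "e 2 1 \<in> hom (X 1) (X' 2)" "e 2 2 \<in> hom (X 2) (X' 2)"
  shows "mat C 2 P P' j' q e \<in> hom P P'"
    "q' 1 \<cdot> mat C 2 P P' j' q e = e 1 1 \<cdot> q 1 \<boxplus> e 1 2 \<cdot> q 2"
    "q' 2 \<cdot> mat C 2 P P' j' q e = e 2 1 \<cdot> q 1 \<boxplus> e 2 2 \<cdot> q 2"
proof -
  have [simp]: "[1..<3] = [1,2]" by (simp add: upt_rec)
  note [simp] = P[unfolded is_dsum_2_iff hom_iff] P'[unfolded is_dsum_2_iff hom_iff] e[unfolded hom_iff]
  have [simp]: "obj (X 1)" "obj (X 2)" "obj (X' 1)" "obj (X' 2)"
    using obj_cod[of "q 1"] obj_cod[of "q 2"] obj_cod[of "q' 1"] obj_cod[of "q' 2"] by simp_all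
  show "mat C 2 P P' j' q e \<in> hom P P'" by (simp add: mat_def msum_def hom_iff)
  show "q' 1 \<cdot> mat C 2 P P' j' q e = e 1 1 \<cdot> q 1 \<boxplus> e 1 2 \<cdot> q 2"
    "q' 2 \<cdot> mat C 2 P P' j' q e = e 2 1 \<cdot> q 1 \<boxplus> e 2 2 \<cdot> q 2"
    by (simp_all add: mat_def msum_def comp_cancel)
qed

lemma mat_3:
  assumes P: "is_dsum C 3 X P j q" and P': "is_dsum C 3 X' P' j' q'"
    and e: "e 1 1 \<in> hom (X 1) (X' 1)" "e 1 2 \<in> hom (X 2) (X' 1)" "e 1 3 \<in> hom (X 3) (X' 1)"
      "e 2 1 \<in> hom (X 1) (X' 2)" "e 2 2 \<in> hom (X 2) (X' 2)" "e 2 3 \<in> hom (X 3) (X' 2)"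
      "e 3 1 \<in> hom (X 1) (X' 3)" "e 3 2 \<in> hom (X 2) (X' 3)" "e 3 3 \<in> hom (X 3) (X' 3)"
  shows "mat C 3 P P' j' q e \<in> hom P P'"
    "q' 1 \<cdot> mat C 3 P P' j' q e = e 1 1 \<cdot> q 1 \<boxplus> e 1 2 \<cdot> q 2 \<boxplus> e 1 3 \<cdot> q 3"
    "q' 2 \<cdot> mat C 3 P P' j' q e = e 2 1 \<cdot> q 1 \<boxplus> e 2 2 \<cdot> q 2 \<boxplus> e 2 3 \<cdot> q 3"
    "q' 3 \<cdot> mat C 3 P P' j' q e = e 3 1 \<cdot> q 1 \<boxplus> e 3 2 \<cdot> q 2 \<boxplus> e 3 3 \<cdot> q 3"
proof -
  have [simp]: "[1..<4] = [1,2,3]" by (simp add: upt_rec)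
  note [simp] = P[unfolded is_dsum_3_iff hom_iff] P'[unfolded is_dsum_3_iff hom_iff] e[unfolded hom_iff]
  have [simp]: "obj (X 1)" "obj (X 2)" "obj (X 3)" "obj (X' 1)" "obj (X' 2)" "obj (X' 3)"
    using obj_cod[of "q 1"] obj_cod[of "q 2"] obj_cod[of "q 3"]
      obj_cod[of "q' 1"] obj_cod[of "q' 2"] obj_cod[of "q' 3"] by simp_all
  show "mat C 3 P P' j' q e \<in> hom P P'" unfolding mat_def by (rule msum_hom) (simp_all add: hom_iff)
  show "q' 1 \<cdot> mat C 3 P P' j' q e = e 1 1 \<cdot> q 1 \<boxplus> e 1 2 \<cdot> q 2 \<boxplus> e 1 3 \<cdot> q 3"
    "q' 2 \<cdot> mat C 3 P P' j' q e = e 2 1 \<cdot> q 1 \<boxplus> e 2 2 \<cdot> q 2 \<boxplus> e 2 3 \<cdot> q 3"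
    "q' 3 \<cdot> mat C 3 P P' j' q e = e 3 1 \<cdot> q 1 \<boxplus> e 3 2 \<cdot> q 2 \<boxplus> e 3 3 \<cdot> q 3"
    unfolding mat_def
    by (subst comp_msum[where Y=P']; simp add: hom_iff comp_cancel; simp add: msum_def)+
qed

end

section \<open>Automorphisms are additive\<close>

locale additive_automorphism = additive_category C for C :: "('o,'m) precat" +
  fixes S :: "'o \<Rightarrow> 'o" and Sm :: "'m \<Rightarrow> 'm"
  assumes automorphism: "automorphism C S Sm"
begin

lemma obj_S [simp]: "obj X \<Longrightarrow> obj (S X)"
  using automorphism by (simp add: automorphism_def is_functor_def)

lemma Sm_simps [simp]:
  assumes "arr f" shows "arr (Sm f)" "dom (Sm f) = S (dom f)" "cod (Sm f) = S (cod f)"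
  using automorphism assms by (simp_all add: automorphism_def is_functor_def hom_iff)

lemma Sm_one [simp]: "obj X \<Longrightarrow> Sm (one X) = one (S X)"
  using automorphism by (simp add: automorphism_def is_functor_def)

lemma Sm_comp [simp]: "arr f \<Longrightarrow> arr g \<Longrightarrow> dom g = cod f \<Longrightarrow> Sm (g \<cdot> f) = Sm g \<cdot> Sm f"
  using automorphism by (simp add: automorphism_def is_functor_def)

text \<open>Surjectivity on arrows gives a preimage, and injectivity on objects forces it into the
  right hom-set.\<close>

lemma Sm_full:
  assumes "u \<in> hom (S X) (S Y)" "obj X" "obj Y"
  obtains v where "v \<in> hom X Y" "Sm v = u"
proof -
  have surj: "Sm ` Arr C = Arr C" and inj: "inj_on S (Obj C)"
    using automorphism by (simp_all add: automorphism_def bij_betw_def)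
  have "u \<in> Sm ` Arr C" unfolding surj using assms(1) by (simp add: hom_iff)
  then obtain v where v: "arr v" "Sm v = u" by auto
  have "S (dom v) = S X" "S (cod v) = S Y"
    using v assms(1) Sm_simps[OF v(1)] by (simp_all add: hom_iff)
  then have "dom v = X" "cod v = Y"
    using v(1) assms(2,3) inj by (simp_all add: inj_on_eq_iff)
  with v that show thesis by (simp add: hom_iff)
qed

lemma S_surj:
  assumes "obj Y" obtains X where "obj X" "S X = Y"
proof -
  have "S ` Obj C = Obj C" using automorphism by (simp add: automorphism_def bij_betw_def)
  with assms have "Y \<in> S ` Obj C" by simp
  with that show thesis by auto
qed

lemma Sm_inj: "Sm f = Sm g \<Longrightarrow> arr f \<Longrightarrow> arr g \<Longrightarrow> f = g"
  using automorphism unfolding automorphism_def bij_betw_def by (elim conjE) (rule inj_onD)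

text \<open>An automorphism is only given as a functor, so its additivity has to be derived. By
  fullness the zero map into \<open>S (zob C)\<close> is the image of a map into a zero object,
  hence of a zero map. Every other zero map factors through such a one.\<close>

lemma Sm_zero [simp]:
  assumes "obj X" "obj Y" shows "Sm (\<zero> X Y) = \<zero> (S X) (S Y)"
proof -
  obtain v where v: "v \<in> hom X (zob C)" "Sm v = \<zero> (S X) (S (zob C))"
    using Sm_full[of "\<zero> (S X) (S (zob C))" X "zob C"] assms by (auto simp: hom_iff)
  then have "Sm (\<zero> X (zob C)) = \<zero> (S X) (S (zob C))"
    using to_zero_obj[OF is_zero_obj_zob v(1)] by simp
  moreover have "Sm (\<zero> (zob C) Y \<cdot> \<zero> X (zob C)) = Sm (\<zero> (zob C) Y) \<cdot> Sm (\<zero> X (zob C))"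
    by (rule Sm_comp) (use assms in simp_all)
  ultimately show ?thesis using assms by simp
qed

lemma Sm_dsum_simps [simp]:
  assumes "obj X" "obj Y"
  shows "Sm (pr1 X Y) \<cdot> Sm (in1 X Y) = one (S X)" "Sm (pr2 X Y) \<cdot> Sm (in2 X Y) = one (S Y)"
    "Sm (pr1 X Y) \<cdot> Sm (in2 X Y) = \<zero> (S Y) (S X)" "Sm (pr2 X Y) \<cdot> Sm (in1 X Y) = \<zero> (S X) (S Y)"
  using assms by (simp_all flip: Sm_comp)

lemma Sm_dsum_ext:
  assumes [simp]: "obj X" "obj Y"
    and u: "u \<in> hom W (S (dsum X Y))" and v: "v \<in> hom W (S (dsum X Y))"
    and eq: "Sm (pr1 X Y) \<cdot> u = Sm (pr1 X Y) \<cdot> v" "Sm (pr2 X Y) \<cdot> u = Sm (pr2 X Y) \<cdot> v"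
  shows "u = v"
proof -
  obtain W' where W': "obj W'" "S W' = W" using S_surj hom_obj[OF u] by blast
  obtain u' where u': "u' \<in> hom W' (dsum X Y)" "Sm u' = u"
    by (rule Sm_full[of u W' "dsum X Y"]) (use u W' in simp_all)
  obtain v' where v': "v' \<in> hom W' (dsum X Y)" "Sm v' = v"
    by (rule Sm_full[of v W' "dsum X Y"]) (use v W' in simp_all)
  have "pr1 X Y \<cdot> u' = pr1 X Y \<cdot> v'" "pr2 X Y \<cdot> u' = pr2 X Y \<cdot> v'"
    by (rule Sm_inj; use eq u' v' in \<open>simp add: hom_iff\<close>)+
  with u' v' have "u' = v'" by (intro dsum_ext[of X Y u' W' v']) simp_all
  with u' v' show ?thesis by simp
qed

text \<open>Addition is encoded by direct sums: f + g is the row [f g] after the diagonal. Both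
  factors are determined by composites with injections or projections, which a functor
  preserves.\<close>

lemma Sm_plus [simp]:
  assumes "arr f" "arr g" "dom g = dom f" "cod g = cod f"
  shows "Sm (f \<boxplus> g) = Sm f \<boxplus> Sm g"
proof -
  define X where "X = dom f"
  note [simp] = assms(1,2) X_def[symmetric] assms(3)[folded X_def] assms(4)
  have [simp]: "obj X" using obj_dom[of f] by simp
  define \<Delta> where "\<Delta> = in1 X X \<boxplus> in2 X X"
  define h where "h = f \<cdot> pr1 X X \<boxplus> g \<cdot> pr2 X X"
  have [simp]: "arr \<Delta>" "dom \<Delta> = X" "cod \<Delta> = dsum X X" "arr h" "dom h = dsum X X" "cod h = cod f"
    unfolding \<Delta>_def h_def by simp_all
  have D: "Sm \<Delta> = Sm (in1 X X) \<boxplus> Sm (in2 X X)"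
  proof (rule Sm_dsum_ext[of X X _ "S X"])
    have "pr1 X X \<cdot> \<Delta> = one X" "pr2 X X \<cdot> \<Delta> = one X" unfolding \<Delta>_def by simp_all
    then have "Sm (pr1 X X) \<cdot> Sm \<Delta> = one (S X)" "Sm (pr2 X X) \<cdot> Sm \<Delta> = one (S X)"
      by (simp_all flip: Sm_comp)
    then show "Sm (pr1 X X) \<cdot> Sm \<Delta> = Sm (pr1 X X) \<cdot> (Sm (in1 X X) \<boxplus> Sm (in2 X X))"
      "Sm (pr2 X X) \<cdot> Sm \<Delta> = Sm (pr2 X X) \<cdot> (Sm (in1 X X) \<boxplus> Sm (in2 X X))"
      by simp_all
  qed (simp_all add: hom_iff)
  have "h \<cdot> in1 X X = f" "h \<cdot> in2 X X = g" unfolding h_def by simp_all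
  then have h: "Sm h \<cdot> Sm (in1 X X) = Sm f" "Sm h \<cdot> Sm (in2 X X) = Sm g"
    by (simp_all flip: Sm_comp)
  have "f \<boxplus> g = h \<cdot> \<Delta>" unfolding h_def \<Delta>_def by (simp add: plus_ac)
  then have "Sm (f \<boxplus> g) = Sm h \<cdot> Sm \<Delta>" by simp
  also have "\<dots> = Sm f \<boxplus> Sm g" unfolding D by (simp add: h)
  finally show ?thesis .
qed

lemma Sm_neg [simp]:
  assumes "arr f" shows "Sm (\<boxminus> f) = \<boxminus> (Sm f)"
proof (rule neg_unique)
  have "Sm f \<boxplus> Sm (\<boxminus> f) = Sm (f \<boxplus> \<boxminus> f)" by (rule Sm_plus[symmetric]) (use assms in simp_all)
  then show "Sm f \<boxplus> Sm (\<boxminus> f) = \<zero> (dom (Sm f)) (cod (Sm f))" using assms by simp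
qed (use assms in simp_all)

text \<open>With additivity at hand the sum formula carries over as well, so the closing map of a
  cone can be treated as an ordinary matrix.\<close>

lemma Sm_is_dsum:
  assumes "is_dsum C 2 X P j q"
  shows "is_dsum C 2 (\<lambda>i. S (X i)) (S P) (\<lambda>i. Sm (j i)) (\<lambda>i. Sm (q i))"
proof -
  note P = assms[unfolded is_dsum_2_iff hom_iff]
  have X: "obj (X 1)" "obj (X 2)" using obj_cod[of "q 1"] obj_cod[of "q 2"] P by simp_all
  have "arr (j 1)" "arr (j 2)" "arr (q 1)" "arr (q 2)" "dom (q 1) = P" "dom (q 2) = P"
    "cod (j 1) = P" "cod (j 2) = P" "dom (j 1) = cod (q 1)" "dom (j 2) = cod (q 2)"
    using P by simp_all
  then have "Sm (j 1) \<cdot> Sm (q 1) \<boxplus> Sm (j 2) \<cdot> Sm (q 2) = Sm (j 1 \<cdot> q 1 \<boxplus> j 2 \<cdot> q 2)"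
    "Sm (q 1) \<cdot> Sm (j 1) = Sm (q 1 \<cdot> j 1)" "Sm (q 1) \<cdot> Sm (j 2) = Sm (q 1 \<cdot> j 2)"
    "Sm (q 2) \<cdot> Sm (j 1) = Sm (q 2 \<cdot> j 1)" "Sm (q 2) \<cdot> Sm (j 2) = Sm (q 2 \<cdot> j 2)"
    by simp_all
  then show ?thesis using P X unfolding is_dsum_2_iff hom_iff by simp
qed

lemma Sm_dsum_comp_simps [simp]:
  assumes "obj X" "obj Y"
  shows "arr u \<Longrightarrow> cod u = S X \<Longrightarrow> Sm (pr1 X Y) \<cdot> Sm (in1 X Y) \<cdot> u = u"
    "arr u \<Longrightarrow> cod u = S Y \<Longrightarrow> Sm (pr2 X Y) \<cdot> Sm (in2 X Y) \<cdot> u = u"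
    "arr u \<Longrightarrow> cod u = S Y \<Longrightarrow> Sm (pr1 X Y) \<cdot> Sm (in2 X Y) \<cdot> u = \<zero> (dom u) (S X)"
    "arr u \<Longrightarrow> cod u = S X \<Longrightarrow> Sm (pr2 X Y) \<cdot> Sm (in1 X Y) \<cdot> u = \<zero> (dom u) (S Y)"
  using assms by (simp_all add: comp_cancel)

section \<open>The reduced cone as a summand of the mapping cone\<close>

text \<open>Here d is the matrix with rows [-a2 0] and [f2 b1]. The inclusion of A2 is the column
  [1; 0] and the retraction is the row [1 a1]. The retraction reproduces d because a2 a1 = 0 and f2
  a1 = b1.\<close>

lemma cone_first:
  assumes hom: "a1 \<in> hom A1 A2" "a2 \<in> hom A2 A3" "b1 \<in> hom A1 B2" "f2 \<in> hom A2 B2"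
      "d \<in> hom (dsum A2 A1) (dsum A3 B2)"
    and a: "a2 \<cdot> a1 = \<zero> A1 A3" and f: "f2 \<cdot> a1 = b1"
    and d: "pr1 A3 B2 \<cdot> d = \<boxminus> (a2 \<cdot> pr1 A2 A1)"
      "pr2 A3 B2 \<cdot> d = f2 \<cdot> pr1 A2 A1 \<boxplus> b1 \<cdot> pr2 A2 A1"
  shows "d \<cdot> in1 A2 A1 = in1 A3 B2 \<cdot> \<boxminus> a2 \<boxplus> in2 A3 B2 \<cdot> f2"
    "(in1 A3 B2 \<cdot> \<boxminus> a2 \<boxplus> in2 A3 B2 \<cdot> f2) \<cdot> (pr1 A2 A1 \<boxplus> a1 \<cdot> pr2 A2 A1) = d"
proof -
  note [simp] = hom[unfolded hom_iff] comp_reduce[OF a] comp_reduce[OF f] comp_reduce[OF d(1)] comp_reduce[OF d(2)] a f d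
  have [simp]: "obj A1" "obj A2" "obj A3" "obj B2"
    using hom_obj[OF hom(1)] hom_obj[OF hom(2)] hom_obj[OF hom(3)] by simp_all
  show "d \<cdot> in1 A2 A1 = in1 A3 B2 \<cdot> \<boxminus> a2 \<boxplus> in2 A3 B2 \<cdot> f2"
    by (rule dsum_ext[of A3 B2 _ A2]) (simp_all add: hom_iff)
  show "(in1 A3 B2 \<cdot> \<boxminus> a2 \<boxplus> in2 A3 B2 \<cdot> f2) \<cdot> (pr1 A2 A1 \<boxplus> a1 \<cdot> pr2 A2 A1) = d"
    by (rule dsum_ext[of A3 B2 _ "dsum A2 A1"]) (simp_all add: hom_iff)
qed

lemma cone_middle:
  assumes hom: "a \<in> hom A A'" "f \<in> hom A B'" "b \<in> hom B B'" "d \<in> hom (dsum A B) (dsum A' B')"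
    and d: "pr1 A' B' \<cdot> d = \<boxminus> (a \<cdot> pr1 A B)" "pr2 A' B' \<cdot> d = f \<cdot> pr1 A B \<boxplus> b \<cdot> pr2 A B"
  shows "d = in1 A' B' \<cdot> \<boxminus> (a \<cdot> pr1 A B) \<boxplus> in2 A' B' \<cdot> (f \<cdot> pr1 A B \<boxplus> b \<cdot> pr2 A B)"
proof -
  have "obj A" "obj A'" "obj B" "obj B'" using hom_obj[OF hom(1)] hom_obj[OF hom(3)] by simp_all
  then show ?thesis using hom
    by (intro dsum_ext[of A' B' d "dsum A B"]) (simp_all add: hom_iff d)
qed

text \<open>\<open>T\<close> stands for the shifted copy of A_1 that is removed, \<open>Z\<close>
  for the zero object put in its place, and \<open>w\<close> for the closing map of B. The column i
  = [-w; 1] works because w f = a, the closing square of a morphism that starts with 1, and w b = 0,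
  a composite of consecutive maps.\<close>

lemma cone_penultimate:
  assumes hom: "a \<in> hom A T" "f \<in> hom A B'" "b \<in> hom B B'" "w \<in> hom B' T"
      "d \<in> hom (dsum A B) (dsum T B')" "z \<in> hom A Z"
    and Z: "is_zero_obj C Z" and w: "w \<cdot> f = a" "w \<cdot> b = \<zero> B T"
    and d: "pr1 T B' \<cdot> d = \<boxminus> (a \<cdot> pr1 A B)" "pr2 T B' \<cdot> d = f \<cdot> pr1 A B \<boxplus> b \<cdot> pr2 A B"
  defines "e \<equiv> in1 Z B' \<cdot> \<boxminus> (z \<cdot> pr1 A B) \<boxplus> in2 Z B' \<cdot> (f \<cdot> pr1 A B \<boxplus> b \<cdot> pr2 A B)"
    and "i \<equiv> in1 T B' \<cdot> \<boxminus> (w \<cdot> pr2 Z B') \<boxplus> in2 T B' \<cdot> pr2 Z B'"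
    and "p \<equiv> in2 Z B' \<cdot> pr2 T B'"
  shows "i \<cdot> e = d" "p \<cdot> d = e" "p \<cdot> i = one (dsum Z B')"
proof -
  note [simp] = hom[unfolded hom_iff] comp_reduce[OF w(1)] comp_reduce[OF w(2)] comp_reduce[OF d(1)] comp_reduce[OF d(2)] w d
  have [simp]: "obj A" "obj T" "obj B" "obj B'" "obj Z"
    using hom_obj[OF hom(1)] hom_obj[OF hom(3)] hom_obj[OF hom(6)] by simp_all
  have [simp]: "pr1 Z B' = \<zero> (dsum Z B') Z" "z = \<zero> A Z"
    using to_zero_obj[OF Z, of "pr1 Z B'" "dsum Z B'"] to_zero_obj[OF Z, of z A] by (simp_all add: hom_iff)
  show "i \<cdot> e = d" unfolding i_def e_def
    by (rule dsum_ext[of T B' _ "dsum A B"]) (simp_all add: hom_iff plus_ac)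
  show "p \<cdot> d = e" unfolding p_def e_def
    by (rule dsum_ext[of Z B' _ "dsum A B"]) (simp_all add: hom_iff)
  show "p \<cdot> i = one (dsum Z B')" unfolding p_def i_def
    by (rule dsum_ext[of Z B' _ "dsum Z B'"]) (simp_all add: hom_iff)
qed

text \<open>The pivot is the identity of \<open>S A1\<close> in the second row of d. After i =
  [-w; 1] that row becomes -w + w = 0, while the first row, -\<open>Sm a1\<close>, turns into
  \<open>Sm a1 \<cdot> w\<close>.\<close>

lemma cone_last:
  assumes hom: "a1 \<in> hom A1 A2" "w \<in> hom B' (S A1)" "d \<in> hom (dsum (S A1) B') (S (dsum A2 A1))"
    and Z: "obj Z"
    and d: "Sm (pr1 A2 A1) \<cdot> d = \<boxminus> (Sm a1 \<cdot> pr1 (S A1) B')"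
      "Sm (pr2 A2 A1) \<cdot> d = pr1 (S A1) B' \<boxplus> w \<cdot> pr2 (S A1) B'"
  defines "i \<equiv> in1 (S A1) B' \<cdot> \<boxminus> (w \<cdot> pr2 Z B') \<boxplus> in2 (S A1) B' \<cdot> pr2 Z B'"
    and "p \<equiv> in2 Z B' \<cdot> pr2 (S A1) B'"
  shows "Sm (in1 A2 A1) \<cdot> Sm a1 \<cdot> w \<cdot> pr2 Z B' = d \<cdot> i"
    "Sm (pr1 A2 A1 \<boxplus> a1 \<cdot> pr2 A2 A1) \<cdot> d = (Sm a1 \<cdot> w \<cdot> pr2 Z B') \<cdot> p"
proof -
  note [simp] = hom[unfolded hom_iff] comp_reduce[OF d(1)] comp_reduce[OF d(2)] d Z
  have [simp]: "obj A1" "obj A2" "obj B'"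
    using hom_obj[OF hom(1)] hom_obj[OF hom(2)] by simp_all
  show "Sm (in1 A2 A1) \<cdot> Sm a1 \<cdot> w \<cdot> pr2 Z B' = d \<cdot> i" unfolding i_def
    by (rule Sm_dsum_ext[of A2 A1 _ "dsum Z B'"]) (simp_all add: hom_iff plus_ac)
  show "Sm (pr1 A2 A1 \<boxplus> a1 \<cdot> pr2 A2 A1) \<cdot> d = (Sm a1 \<cdot> w \<cdot> pr2 Z B') \<cdot> p" unfolding p_def
    by simp
qed

section \<open>The octahedral sequence as a summand of the iterated reduced cone\<close>

text \<open>
  The parameters \<open>g\<close>, \<open>t\<close>, \<open>h\<close> serve only the case k = 2, where D lacks the third summand of the
  iterated reduced cone; for larger k they are 1, 0, 1.
\<close>

definition incl where
  "incl A B Z k g Q = in1 (dsum A B) Z \<cdot> (in1 A B \<cdot> sgnm C (Suc k) (Q (1::nat)) \<boxplus> in2 A B \<cdot> Q 2)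
    \<boxplus> in2 (dsum A B) Z \<cdot> g \<cdot> Q 3"

definition retr where
  "retr A B Z k t h J = J (1::nat) \<cdot> sgnm C (Suc k) (pr1 A B \<cdot> pr1 (dsum A B) Z)
    \<boxplus> J 2 \<cdot> (pr2 A B \<cdot> pr1 (dsum A B) Z \<boxplus> t \<cdot> pr2 (dsum A B) Z)
    \<boxplus> J 3 \<cdot> h \<cdot> pr2 (dsum A B) Z"

text \<open>In coordinates the retraction after the inclusion gives the square of a sign on
  \<open>Q 1\<close>, then \<open>Q 2\<close> plus \<open>t \<cdot> g \<cdot> Q 3\<close>, and
  finally \<open>h \<cdot> g \<cdot> Q 3\<close>. The assumptions \<open>hg\<close> and
  \<open>tg\<close> make this the identity.\<close>

lemma incl_retr:
  assumes P: "is_dsum C 3 (three A B D) P J Q"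
    and hom: "g \<in> hom D Z" "h \<in> hom Z D" "t \<in> hom Z B"
    and hg: "h \<cdot> g = one D" and tg: "t \<cdot> g = \<zero> D B"
  shows "incl A B Z k g Q \<in> hom P (dsum (dsum A B) Z)"
    "retr A B Z k t h J \<in> hom (dsum (dsum A B) Z) P"
    "pr1 A B \<cdot> pr1 (dsum A B) Z \<cdot> incl A B Z k g Q = sgnm C (Suc k) (Q 1)"
    "pr2 A B \<cdot> pr1 (dsum A B) Z \<cdot> incl A B Z k g Q = Q 2"
    "pr2 (dsum A B) Z \<cdot> incl A B Z k g Q = g \<cdot> Q 3"
    "Q 1 \<cdot> retr A B Z k t h J = sgnm C (Suc k) (pr1 A B \<cdot> pr1 (dsum A B) Z)"
    "Q 2 \<cdot> retr A B Z k t h J = pr2 A B \<cdot> pr1 (dsum A B) Z \<boxplus> t \<cdot> pr2 (dsum A B) Z"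
    "Q 3 \<cdot> retr A B Z k t h J = h \<cdot> pr2 (dsum A B) Z"
    "retr A B Z k t h J \<cdot> incl A B Z k g Q = one P"
proof -
  have [simp]: "three A B D 1 = A" "three A B D 2 = B" "three A B D 3 = D" by (simp_all add: three_def)
  note [simp] = P[unfolded is_dsum_3_iff hom_iff, simplified]
  note [simp] = hom[unfolded hom_iff] comp_reduce[OF hg] comp_reduce[OF tg] hg tg
  have [simp]: "obj A" "obj B" "obj D" "obj Z"
    using obj_cod[of "Q 1"] hom_obj[OF hom(1)] hom_obj[OF hom(3)] by simp_all
  show i: "incl A B Z k g Q \<in> hom P (dsum (dsum A B) Z)" by (simp add: incl_def hom_iff)
  show p: "retr A B Z k t h J \<in> hom (dsum (dsum A B) Z) P" by (simp add: retr_def hom_iff)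
  show q: "Q 1 \<cdot> retr A B Z k t h J = sgnm C (Suc k) (pr1 A B \<cdot> pr1 (dsum A B) Z)"
    "Q 2 \<cdot> retr A B Z k t h J = pr2 A B \<cdot> pr1 (dsum A B) Z \<boxplus> t \<cdot> pr2 (dsum A B) Z"
    "Q 3 \<cdot> retr A B Z k t h J = h \<cdot> pr2 (dsum A B) Z"
    by (simp_all add: retr_def comp_cancel)
  show r: "pr1 A B \<cdot> pr1 (dsum A B) Z \<cdot> incl A B Z k g Q = sgnm C (Suc k) (Q 1)"
    "pr2 A B \<cdot> pr1 (dsum A B) Z \<cdot> incl A B Z k g Q = Q 2"
    "pr2 (dsum A B) Z \<cdot> incl A B Z k g Q = g \<cdot> Q 3"
    by (simp_all add: incl_def)
  note [simp] = i[unfolded hom_iff] p[unfolded hom_iff] r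
  show "retr A B Z k t h J \<cdot> incl A B Z k g Q = one P"
  proof (rule dsum_3_ext[OF P, of _ P])
    have "Q 1 \<cdot> retr A B Z k t h J \<cdot> incl A B Z k g Q = sgnm C (Suc k) (sgnm C (Suc k) (Q 1))"
      by (simp add: comp_reduce[OF q(1)] sgnm_def)
    then show "Q 1 \<cdot> retr A B Z k t h J \<cdot> incl A B Z k g Q = Q 1 \<cdot> one P" by (simp add: sgnm_def)
  qed (simp_all add: comp_reduce[OF q(2)] comp_reduce[OF q(3)] hom_iff)
qed

text \<open>F contains -e, so its entries on A and B are a, -f and -b. The signs at k and
  \<open>Suc k\<close> differ, which changes a to -a and produces the signs of d. The parameters on
  the target side are 1, 0, 1 since the lemma is applied with \<open>Suc k\<close> at least 3. The
  conditions \<open>cg\<close>, \<open>bt\<close> and \<open>c\<close> compare the third columns.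
  When g, t, h are 1, 0, 1 they just say c0 = c; the real content is at position 2.\<close>

lemma incl_retr_middle:
  assumes P: "is_dsum C 3 (three A B D) P J Q" and P': "is_dsum C 3 (three A' B' Z') P' J' Q'"
    and hom: "g \<in> hom D Z" "h \<in> hom Z D" "t \<in> hom Z B" "a \<in> hom A A'" "b \<in> hom B B'" "c \<in> hom Z Z'"
      "c0 \<in> hom D Z'" "f \<in> hom A B'" "\<theta> \<in> hom (dsum A B) Z'" "d \<in> hom P P'"
    and hg: "h \<cdot> g = one D" and tg: "t \<cdot> g = \<zero> D B" and cg: "c \<cdot> g = c0" and bt: "b \<cdot> t = \<zero> Z B'"
    and c: "\<theta> \<cdot> in2 A B \<cdot> t \<boxplus> c0 \<cdot> h = c"
    and d: "Q' 1 \<cdot> d = \<boxminus> (a \<cdot> Q 1)" "Q' 2 \<cdot> d = sgnm C k f \<cdot> Q 1 \<boxplus> \<boxminus> (b \<cdot> Q 2)"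
      "Q' 3 \<cdot> d = sgnm C (Suc k) (\<theta> \<cdot> in1 A B) \<cdot> Q 1 \<boxplus> (\<theta> \<cdot> in2 A B) \<cdot> Q 2 \<boxplus> c0 \<cdot> Q 3"
  defines "e \<equiv> in1 A' B' \<cdot> \<boxminus> (a \<cdot> pr1 A B) \<boxplus> in2 A' B' \<cdot> (f \<cdot> pr1 A B \<boxplus> b \<cdot> pr2 A B)"
  defines "F \<equiv> in1 (dsum A' B') Z' \<cdot> \<boxminus> (e \<cdot> pr1 (dsum A B) Z)
      \<boxplus> in2 (dsum A' B') Z' \<cdot> (\<theta> \<cdot> pr1 (dsum A B) Z \<boxplus> c \<cdot> pr2 (dsum A B) Z)"
  shows "incl A' B' Z' (Suc k) (one Z') Q' \<cdot> d = F \<cdot> incl A B Z k g Q"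
    "retr A' B' Z' (Suc k) (\<zero> Z' B') (one Z') J' \<cdot> F = d \<cdot> retr A B Z k t h J"
proof -
  have [simp]: "three A B D 1 = A" "three A B D 2 = B" "three A B D 3 = D"
    "three A' B' Z' 1 = A'" "three A' B' Z' 2 = B'" "three A' B' Z' 3 = Z'" by (simp_all add: three_def)
  note [simp] = P[unfolded is_dsum_3_iff hom_iff, simplified] P'[unfolded is_dsum_3_iff hom_iff, simplified]
  note [simp] = hom[unfolded hom_iff]
  have [simp]: "obj A" "obj B" "obj D" "obj Z" "obj A'" "obj B'" "obj Z'"
    using hom_obj[OF hom(1)] hom_obj[OF hom(4)] hom_obj[OF hom(5)] hom_obj[OF hom(6)] by simp_all
  note ir = incl_retr[OF P hom(1-3) hg tg]
  have o: "one Z' \<in> hom Z' Z'" "\<zero> Z' B' \<in> hom Z' B'" "one Z' \<cdot> one Z' = one Z'" "\<zero> Z' B' \<cdot> one Z' = \<zero> Z' B'"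
    by (simp_all add: hom_iff)
  note ir' = incl_retr[OF P' o(1,1,2,3,4)]
  have [simp]: "arr e" "dom e = dsum A B" "cod e = dsum A' B'" unfolding e_def by simp_all
  have [simp]: "arr F" "dom F = dsum (dsum A B) Z" "cod F = dsum (dsum A' B') Z'" unfolding F_def by simp_all
  have e: "pr1 A' B' \<cdot> e = \<boxminus> (a \<cdot> pr1 A B)" "pr2 A' B' \<cdot> e = f \<cdot> pr1 A B \<boxplus> b \<cdot> pr2 A B"
    unfolding e_def by simp_all
  have F: "pr1 (dsum A' B') Z' \<cdot> F = \<boxminus> (e \<cdot> pr1 (dsum A B) Z)"
     "pr2 (dsum A' B') Z' \<cdot> F = \<theta> \<cdot> pr1 (dsum A B) Z \<boxplus> c \<cdot> pr2 (dsum A B) Z"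
    unfolding F_def by simp_all
  note [simp] = ir(1,2)[unfolded hom_iff, simplified] ir'(1,2)[unfolded hom_iff, simplified]
  have \<theta>: "\<theta> \<cdot> u = (\<theta> \<cdot> in1 A B) \<cdot> pr1 A B \<cdot> u \<boxplus> (\<theta> \<cdot> in2 A B) \<cdot> pr2 A B \<cdot> u" if "u \<in> hom W (dsum A B)" for u W
  proof -
    have "\<theta> \<cdot> u = \<theta> \<cdot> (in1 A B \<cdot> pr1 A B \<boxplus> in2 A B \<cdot> pr2 A B) \<cdot> u"
      using that by (subst in_pr) (simp_all add: hom_iff)
    then show ?thesis using that by (simp add: hom_iff)
  qed
  have i: "pr1 (dsum A' B') Z' \<cdot> incl A' B' Z' (Suc k) (one Z') Q' \<cdot> d
      = pr1 (dsum A' B') Z' \<cdot> F \<cdot> incl A B Z k g Q"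
  proof (rule dsum_ext[of A' B' _ P])
    show "pr1 A' B' \<cdot> pr1 (dsum A' B') Z' \<cdot> incl A' B' Z' (Suc k) (one Z') Q' \<cdot> d
      = pr1 A' B' \<cdot> pr1 (dsum A' B') Z' \<cdot> F \<cdot> incl A B Z k g Q"
      using comp_reduce[OF ir'(3)[of "Suc k"], of d]
      by (simp add: comp_reduce[OF F(1)] comp_reduce[OF e(1)] ir(3) d) (simp add: sgnm_def d)
    show "pr2 A' B' \<cdot> pr1 (dsum A' B') Z' \<cdot> incl A' B' Z' (Suc k) (one Z') Q' \<cdot> d
      = pr2 A' B' \<cdot> pr1 (dsum A' B') Z' \<cdot> F \<cdot> incl A B Z k g Q"
      using comp_reduce[OF ir'(4)[of "Suc k"], of d]
      by (simp add: comp_reduce[OF F(1)] comp_reduce[OF e(2)] ir(3,4) d) (simp add: sgnm_def)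
  qed (simp_all add: hom_iff)
  show "incl A' B' Z' (Suc k) (one Z') Q' \<cdot> d = F \<cdot> incl A B Z k g Q"
  proof (rule dsum_ext[of "dsum A' B'" Z' _ P])
    show "pr2 (dsum A' B') Z' \<cdot> incl A' B' Z' (Suc k) (one Z') Q' \<cdot> d
      = pr2 (dsum A' B') Z' \<cdot> F \<cdot> incl A B Z k g Q"
      using \<theta>[of "pr1 (dsum A B) Z \<cdot> incl A B Z k g Q" P]
      by (simp add: comp_reduce[OF F(2)] comp_reduce[OF ir'(5)] ir(3-5) d hom_iff comp_reduce[OF cg])
        (simp add: sgnm_def)
  qed (simp_all add: i hom_iff)
  have c': "\<theta> \<cdot> in2 A B \<cdot> t \<cdot> u \<boxplus> c0 \<cdot> h \<cdot> u = c \<cdot> u" if "u \<in> hom W Z" for u W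
    unfolding c[symmetric] using that by (simp add: hom_iff)
  show "retr A' B' Z' (Suc k) (\<zero> Z' B') (one Z') J' \<cdot> F = d \<cdot> retr A B Z k t h J"
  proof (rule dsum_3_ext[OF P', of _ "dsum (dsum A B) Z"])
    show "Q' 1 \<cdot> retr A' B' Z' (Suc k) (\<zero> Z' B') (one Z') J' \<cdot> F = Q' 1 \<cdot> d \<cdot> retr A B Z k t h J"
      by (simp add: comp_reduce[OF ir'(6)] comp_reduce[OF d(1)] ir(6))
        (simp add: sgnm_def F comp_reduce[OF e(1)])
    show "Q' 2 \<cdot> retr A' B' Z' (Suc k) (\<zero> Z' B') (one Z') J' \<cdot> F = Q' 2 \<cdot> d \<cdot> retr A B Z k t h J"
      by (simp add: comp_reduce[OF ir'(7)] comp_reduce[OF d(2)] ir(6,7) F comp_reduce[OF e(2)] comp_reduce[OF bt])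
        (simp add: sgnm_def)
    show "Q' 3 \<cdot> retr A' B' Z' (Suc k) (\<zero> Z' B') (one Z') J' \<cdot> F = Q' 3 \<cdot> d \<cdot> retr A B Z k t h J"
      using \<theta>[of "pr1 (dsum A B) Z" "dsum (dsum A B) Z"] c'[of "pr2 (dsum A B) Z" "dsum (dsum A B) Z"]
      by (simp add: comp_reduce[OF ir'(8)] comp_reduce[OF d(3)] ir(6-8) F hom_iff)
        (simp add: sgnm_def)
  qed (simp_all add: hom_iff)
qed

text \<open>Here \<open>Z\<close> is B_2 and the last row of F is the projection onto it, so this
  copy of B_2 is the pivot. The term \<open>b\<close> in the retraction is the correction made by
  the elimination: it cancels the entry -b of F. The first map of D contains +a, so the sign on the
  A-component at position 1 equals the one at position 2 instead of alternating.\<close>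

lemma incl_retr_first:
  assumes P: "is_dsum C 3 (three A B D) P J Q" and D: "is_zero_obj C D"
    and hom: "a \<in> hom A3 A" "f \<in> hom A3 B" "b \<in> hom Z B"
  defines "d \<equiv> J 1 \<cdot> a \<boxplus> J 2 \<cdot> f"
  defines "e \<equiv> in1 A B \<cdot> \<boxminus> (a \<cdot> pr1 A3 Z) \<boxplus> in2 A B \<cdot> (f \<cdot> pr1 A3 Z \<boxplus> b \<cdot> pr2 A3 Z)"
  defines "F \<equiv> in1 (dsum A B) Z \<cdot> \<boxminus> e \<boxplus> in2 (dsum A B) Z \<cdot> pr2 A3 Z"
  assumes g: "g \<in> hom D Z" and h: "h \<in> hom Z D"
  shows "incl A B Z 2 g Q \<cdot> d = F \<cdot> \<boxminus> (in1 A3 Z)"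
    "retr A B Z 2 b h J \<cdot> F = d \<cdot> \<boxminus> (pr1 A3 Z)"
proof -
  have [simp]: "three A B D 1 = A" "three A B D 2 = B" "three A B D 3 = D" by (simp_all add: three_def)
  note [simp] = P[unfolded is_dsum_3_iff hom_iff, simplified] hom[unfolded hom_iff]
  have [simp]: "obj A" "obj B" "obj D" "obj Z" "obj A3"
    using hom_obj[OF hom(1)] hom_obj[OF hom(3)] D by (simp_all add: is_zero_obj_def)
  have g0: "g = \<zero> D Z" and h0: "h = \<zero> Z D" using to_zero_obj[OF D h] from_zero_obj[OF D g] by simp_all
  show "incl A B Z 2 g Q \<cdot> d = F \<cdot> \<boxminus> (in1 A3 Z)"
    unfolding d_def e_def F_def g0 incl_def sgnm_def by (simp add: comp_cancel)
  show "retr A B Z 2 b h J \<cdot> F = d \<cdot> \<boxminus> (pr1 A3 Z)"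
    unfolding d_def e_def F_def h0 retr_def sgnm_def
    by (simp add: comp_cancel plus_neg_cancel_left plus_ac)
qed

text \<open>The component of \<open>e\<close> through f2 is killed by c, so only -a2 contributes.
  Its sign is absorbed by the minus sign chosen at position 1.\<close>

lemma incl_retr_last:
  assumes P: "is_dsum C 3 (three A B Z) P J Q"
    and hom: "a2 \<in> hom A2 A3" "f2 \<in> hom A2 B2" "c \<in> hom Z (S A2)"
    and fc: "Sm f2 \<cdot> c = \<zero> Z (S B2)"
  defines "e \<equiv> in1 A3 B2 \<cdot> \<boxminus> a2 \<boxplus> in2 A3 B2 \<cdot> f2"
  shows "Sm (\<boxminus> (in1 A3 B2)) \<cdot> Sm a2 \<cdot> c \<cdot> Q 3 = (Sm e \<cdot> c \<cdot> pr2 (dsum A B) Z) \<cdot> incl A B Z k (one Z) Q"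
    "Sm (\<boxminus> (pr1 A3 B2)) \<cdot> Sm e \<cdot> c \<cdot> pr2 (dsum A B) Z = (Sm a2 \<cdot> c \<cdot> Q 3) \<cdot> retr A B Z k (\<zero> Z B) (one Z) J"
proof -
  have [simp]: "three A B Z 1 = A" "three A B Z 2 = B" "three A B Z 3 = Z" by (simp_all add: three_def)
  note [simp] = P[unfolded is_dsum_3_iff hom_iff, simplified] hom[unfolded hom_iff] comp_reduce[OF fc] fc
  have [simp]: "obj A" "obj B" "obj Z" "obj A3" "obj A2" "obj B2"
    using hom_obj[OF hom(1)] hom_obj[OF hom(2)] hom_obj[OF hom(3)] obj_cod[of "Q 1"] obj_cod[of "Q 2"] by simp_all
  have o: "one Z \<in> hom Z Z" "\<zero> Z B \<in> hom Z B" "one Z \<cdot> one Z = one Z" "\<zero> Z B \<cdot> one Z = \<zero> Z B"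
    by (simp_all add: hom_iff)
  note ir = incl_retr[OF P o(1,1,2,3,4)]
  note [simp] = ir(1,2)[unfolded hom_iff, simplified] ir(5,8)
  show "Sm (\<boxminus> (in1 A3 B2)) \<cdot> Sm a2 \<cdot> c \<cdot> Q 3 = (Sm e \<cdot> c \<cdot> pr2 (dsum A B) Z) \<cdot> incl A B Z k (one Z) Q"
    unfolding e_def by simp
  show "Sm (\<boxminus> (pr1 A3 B2)) \<cdot> Sm e \<cdot> c \<cdot> pr2 (dsum A B) Z = (Sm a2 \<cdot> c \<cdot> Q 3) \<cdot> retr A B Z k (\<zero> Z B) (one Z) J"
    unfolding e_def by simp
qed

end

section \<open>Consequences of the axioms\<close>

locale n_angulated = additive_automorphism C S Sm
  for C :: "('o,'m) precat" and S :: "'o \<Rightarrow> 'o" and Sm :: "'m \<Rightarrow> 'm" +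
  fixes n :: nat and N :: "('o,'m) seq set"
  assumes n3: "3 \<le> n" and N_seq: "\<forall>X\<in>N. is_seq C S n X"
    and N1: "N1 C S Sm n N" and N2: "N2 C S Sm n N" and N3: "N3 C S Sm n N" and N4: "N4 C S Sm n N"
begin

section \<open>Sequences, their morphisms and direct summands\<close>

lemma seqD:
  assumes "is_seq C S n X"
  shows "1 \<le> i \<Longrightarrow> i \<le> n \<Longrightarrow> obj (fst X i)"
    "1 \<le> i \<Longrightarrow> i < n \<Longrightarrow> snd X i \<in> hom (fst X i) (fst X (Suc i))"
    "snd X n \<in> hom (fst X n) (S (fst X 1))"
  using assms by (auto simp: is_seq_def Let_def)

lemma seqmorD:
  assumes "is_seqmor C Sm n X Y \<phi>"
  shows "1 \<le> i \<Longrightarrow> i \<le> n \<Longrightarrow> \<phi> i \<in> hom (fst X i) (fst Y i)"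
    "1 \<le> i \<Longrightarrow> i < n \<Longrightarrow> \<phi> (Suc i) \<cdot> snd X i = snd Y i \<cdot> \<phi> i"
    "Sm (\<phi> 1) \<cdot> snd X n = snd Y n \<cdot> \<phi> n"
  using assms by (auto simp: is_seqmor_def Let_def)

lemma summand:
  assumes "is_seq C S n X" "Y \<in> N" "is_seqmor C Sm n X Y \<phi>" "is_seqmor C Sm n Y X \<psi>"
    "\<And>i. 1 \<le> i \<Longrightarrow> i \<le> n \<Longrightarrow> \<psi> i \<cdot> \<phi> i = one (fst X i)"
  shows "X \<in> N"
proof -
  have "\<exists>\<phi> \<psi>. is_seqmor C Sm n X Y \<phi> \<and> is_seqmor C Sm n Y X \<psi> \<and> (\<forall>i\<in>{1..n}. \<psi> i \<cdot> \<phi> i = one (fst X i))"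
    using assms(3-5) by (intro exI[of _ \<phi>] exI[of _ \<psi>]) auto
  moreover have "\<forall>X Y. is_seq C S n X \<longrightarrow> Y \<in> N \<longrightarrow>
        (\<exists>\<phi> \<psi>. is_seqmor C Sm n X Y \<phi> \<and> is_seqmor C Sm n Y X \<psi> \<and>
               (\<forall>i\<in>{1..n}. \<psi> i \<cdot> \<phi> i = one (fst X i))) \<longrightarrow> X \<in> N"
    using N1 unfolding N1_def by (elim conjE)
  ultimately show ?thesis using assms(1,2) by blast
qed

text \<open>A sequence is a pair of total functions, so agreement on the indices 1 to n is not
  equality. The identities nevertheless make one sequence a summand of the other.\<close>

lemma seq_cong:
  assumes "Y \<in> N" "\<And>i. 1 \<le> i \<Longrightarrow> i \<le> n \<Longrightarrow> fst X i = fst Y i" "\<And>i. 1 \<le> i \<Longrightarrow> i \<le> n \<Longrightarrow> snd X i = snd Y i"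
  shows "X \<in> N"
proof (rule summand[of X Y "\<lambda>i. one (fst Y i)" "\<lambda>i. one (fst Y i)"])
  have Y: "is_seq C S n Y" using assms(1) N_seq by simp
  note D = seqD[OF Y]
  show "is_seq C S n X" using D n3 assms(2,3) by (auto simp: is_seq_def Let_def)
  show "is_seqmor C Sm n X Y (\<lambda>i. one (fst Y i))" "is_seqmor C Sm n Y X (\<lambda>i. one (fst Y i))"
    using D n3 assms(2,3) by (auto simp: is_seqmor_def Let_def hom_iff)
  show "one (fst Y i) \<cdot> one (fst Y i) = one (fst X i)" if "1 \<le> i" "i \<le> n" for i
    using that D assms(2) by simp
qed (rule assms(1))

section \<open>Consecutive maps of an n-angle compose to zero\<close>

lemma comp_first:
  assumes X: "X \<in> N" shows "snd X 2 \<cdot> snd X 1 = \<zero> (fst X 1) (fst X 3)"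
proof -
  note D = seqD[OF N_seq[rule_format, OF X]]
  let ?T = "triv_seq C S n (fst X 1)"
  have D1: "obj (fst X 1)" and h1: "snd X 1 \<in> hom (fst X 1) (fst X 2)" using D(1)[of 1] D(2)[of 1] n3 by (simp_all add: numeral_2_eq_2 One_nat_def)
  have T: "?T \<in> N" using N1 D1 by (simp add: N1_def)
  \<comment> \<open>By (N3) the pair (1, \<alpha>_1) extends to a morphism from the trivial n-angle
    to X. Its third component starts at a zero object, so its second square reads \<alpha>_2
    \<alpha>_1 = 0.\<close>
  have "\<exists>\<phi>. \<phi> 1 = one (fst X 1) \<and> \<phi> 2 = snd X 1 \<and> is_seqmor C Sm n ?T X \<phi>"
    using N3[unfolded N3_def, rule_format, OF T X, of "one (fst X 1)" "snd X 1"] D1 h1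
    by (simp add: triv_seq_def Let_def hom_iff)
  then obtain \<phi> where \<phi>: "\<phi> 2 = snd X 1" "is_seqmor C Sm n ?T X \<phi>" by blast
  have "\<phi> 3 \<cdot> snd ?T 2 = snd X 2 \<cdot> \<phi> 2" "\<phi> 3 \<in> hom (zob C) (fst X 3)"
    using n3 seqmorD(2)[OF \<phi>(2), of 2] seqmorD(1)[OF \<phi>(2), of 3] by (simp_all add: Let_def triv_seq_def)
  moreover have "snd ?T 2 = \<zero> (fst X 1) (zob C)" using n3 by (simp add: triv_seq_def Let_def)
  ultimately show ?thesis using \<phi>(1) D1 by (simp add: hom_iff)
qed

lemma rot_simps:
  "i < n \<Longrightarrow> fst (rot C S Sm n X) i = fst X (Suc i)" "i < n \<Longrightarrow> snd (rot C S Sm n X) i = snd X (Suc i)"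
  "snd (rot C S Sm n X) n = sgnm C n (Sm (snd X 1))"
  by (simp_all add: rot_def Let_def)

lemma rot_N: "X \<in> N \<Longrightarrow> rot C S Sm n X \<in> N"
  using N2 N_seq unfolding N2_def by blast

text \<open>Rotation lowers the position of a pair by one until \<open>comp_first\<close> applies.
  The target is written as a codomain because for i = n - 1 it is the shift of the first
  object.\<close>

lemma comp_consecutive:
  "X \<in> N \<Longrightarrow> 1 \<le> i \<Longrightarrow> i < n \<Longrightarrow> snd X (Suc i) \<cdot> snd X i = \<zero> (fst X i) (cod (snd X (Suc i)))"
proof (induction i arbitrary: X)
  case (Suc i)
  show ?case
  proof (cases "i = 0")
    case True
    have "snd X 2 \<in> hom (fst X 2) (fst X 3)" using seqD(2)[of X 2] N_seq Suc.prems n3 by (simp add: numeral_3_eq_3)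
    then show ?thesis using comp_first[OF Suc.prems(1)] True by (simp add: numeral_2_eq_2 One_nat_def hom_iff)
  next
    case False
    then show ?thesis using Suc.IH[OF rot_N[OF Suc.prems(1)]] Suc.prems by (simp add: rot_simps)
  qed
qed simp

text \<open>This is the last pair before the closing map of the rotated sequence, up to the sign
  (-1)^n, which does not affect vanishing.\<close>

lemma comp_last:
  assumes "X \<in> N" shows "Sm (snd X 1) \<cdot> snd X n = \<zero> (fst X n) (S (fst X 2))"
proof -
  obtain m where m: "n = Suc m" "1 \<le> m" using n3 by (cases n) auto
  note D = seqD[OF N_seq[rule_format, OF assms]]
  have h: "snd X 1 \<in> hom (fst X 1) (fst X 2)" "snd X n \<in> hom (fst X n) (S (fst X 1))"
    using D(2)[of 1] D(3) n3 by (simp_all add: numeral_2_eq_2 One_nat_def)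
  have "sgnm C n (Sm (snd X 1)) \<cdot> snd X n = \<zero> (fst X n) (S (fst X 2))"
    using comp_consecutive[OF rot_N[OF assms], of m] rot_simps(1,2)[of m X] rot_simps(3)[of X] m h
    by (simp add: hom_iff)
  then have "Sm (snd X 1) \<cdot> snd X n = \<zero> (fst X n) (S (fst X 2)) \<or>
    \<boxminus> (Sm (snd X 1) \<cdot> snd X n) = \<zero> (fst X n) (S (fst X 2))"
    using h by (cases "even n") (simp_all add: sgnm_def hom_iff)
  then show ?thesis
  proof
    assume *: "\<boxminus> (Sm (snd X 1) \<cdot> snd X n) = \<zero> (fst X n) (S (fst X 2))"
    have "Sm (snd X 1) \<cdot> snd X n = \<boxminus> (\<boxminus> (Sm (snd X 1) \<cdot> snd X n))" using h by (simp add: hom_iff)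
    also have "\<dots> = \<zero> (fst X n) (S (fst X 2))"
      unfolding * using hom_obj[OF h(1)] hom_obj[OF h(2)] by simp
    finally show ?thesis .
  qed
qed

section \<open>Coordinates of the mapping cone\<close>

lemma cone_obj:
  "fst (cone C S Sm n X Y \<phi>) k = dsum (if k < n then fst X (Suc k) else S (fst X 1)) (fst Y k)"
  by (simp add: cone_def Let_def dsum_def)

text \<open>The case distinction in \<open>A'\<close> is the step k = n - 1, where the first summand
  of the target is already the shift of the first object of X.\<close>

lemma cone_map:
  assumes X: "is_seq C S n X" and Y: "is_seq C S n Y" and \<phi>: "is_seqmor C Sm n X Y \<phi>"
    and k: "1 \<le> k" "k < n"
  defines "A \<equiv> fst X (Suc k)" and "A' \<equiv> (if Suc k < n then fst X (Suc (Suc k)) else S (fst X 1))"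
    and "d \<equiv> snd (cone C S Sm n X Y \<phi>) k"
  shows "d \<in> hom (dsum A (fst Y k)) (dsum A' (fst Y (Suc k)))"
    "pr1 A' (fst Y (Suc k)) \<cdot> d = \<boxminus> (snd X (Suc k) \<cdot> pr1 A (fst Y k))"
    "pr2 A' (fst Y (Suc k)) \<cdot> d = \<phi> (Suc k) \<cdot> pr1 A (fst Y k) \<boxplus> snd Y k \<cdot> pr2 A (fst Y k)"
proof -
  let ?B = "fst Y k" and ?B' = "fst Y (Suc k)"
  let ?e = "\<lambda>(r::nat) (c::nat). if r = 1 \<and> c = 1 then negm C (snd X (Suc k))
                 else if r = 1 \<and> c = 2 then zerm C ?B A'
                 else if r = 2 \<and> c = 1 then \<phi> (Suc k)
                 else snd Y k"
  have d: "d = mat C 2 (dsum A ?B) (dsum A' ?B') (fst (snd (dsdata C 2 (two A' ?B'))))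
      (snd (snd (dsdata C 2 (two A ?B)))) ?e"
    using k unfolding d_def A_def A'_def cone_def Let_def dsum_def by simp
  have o: "obj A" "obj A'" "obj ?B" "obj ?B'"
    using seqD(1)[OF X] seqD(1)[OF Y] k unfolding A_def A'_def by simp_all
  have a: "snd X (Suc k) \<in> hom A A'"
  proof (cases "Suc k < n")
    case True
    then show ?thesis unfolding A_def A'_def using seqD(2)[OF X, of "Suc k"] by simp
  next
    case False
    then have "n = Suc k" using k by simp
    then show ?thesis unfolding A_def A'_def using seqD(3)[OF X] by simp
  qed
  have b: "snd Y k \<in> hom ?B ?B'" using seqD(2)[OF Y] k by simp
  have f: "\<phi> (Suc k) \<in> hom A ?B'" using \<phi> k by (simp add: is_seqmor_def Let_def A_def)
  have "?e 1 1 \<in> hom (two A ?B 1) (two A' ?B' 1)" "?e 1 2 \<in> hom (two A ?B 2) (two A' ?B' 1)"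
    "?e 2 1 \<in> hom (two A ?B 1) (two A' ?B' 2)" "?e 2 2 \<in> hom (two A ?B 2) (two A' ?B' 2)"
    using a b f o by (simp_all add: two_def hom_iff)
  note m = mat_2[OF is_dsum_dsum[OF o(1,3)] is_dsum_dsum[OF o(2,4)] this, folded d pr1_def pr2_def]
  show "d \<in> hom (dsum A ?B) (dsum A' ?B')" "pr1 A' ?B' \<cdot> d = \<boxminus> (snd X (Suc k) \<cdot> pr1 A ?B)"
    "pr2 A' ?B' \<cdot> d = \<phi> (Suc k) \<cdot> pr1 A ?B \<boxplus> snd Y k \<cdot> pr2 A ?B"
    using m a b f o by (simp_all add: hom_iff)
qed

lemma cone_map_last:
  assumes X: "is_seq C S n X" and Y: "is_seq C S n Y" and \<phi>: "is_seqmor C Sm n X Y \<phi>"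
  defines "T \<equiv> S (fst X 1)" and "d \<equiv> snd (cone C S Sm n X Y \<phi>) n"
  shows "d \<in> hom (dsum T (fst Y n)) (S (dsum (fst X 2) (fst Y 1)))"
    "Sm (pr1 (fst X 2) (fst Y 1)) \<cdot> d = \<boxminus> (Sm (snd X 1) \<cdot> pr1 T (fst Y n))"
    "Sm (pr2 (fst X 2) (fst Y 1)) \<cdot> d = Sm (\<phi> 1) \<cdot> pr1 T (fst Y n) \<boxplus> snd Y n \<cdot> pr2 T (fst Y n)"
proof -
  let ?B = "fst Y n" and ?A' = "fst X 2" and ?B' = "fst Y 1"
  let ?e = "\<lambda>(r::nat) (c::nat). if r = 1 \<and> c = 1 then negm C (Sm (snd X 1))
                 else if r = 1 \<and> c = 2 then zerm C ?B (S ?A')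
                 else if r = 2 \<and> c = 1 then Sm (\<phi> 1)
                 else snd Y n"
  have two: "Suc 1 = 2" "1 < n" "1 \<le> n" "2 \<le> n" using n3 by simp_all
  have d: "d = mat C 2 (dsum T ?B) (S (dsum ?A' ?B')) (\<lambda>r. Sm (fst (snd (dsdata C 2 (two ?A' ?B'))) r))
      (snd (snd (dsdata C 2 (two T ?B)))) ?e"
    using n3 unfolding d_def T_def cone_def Let_def dsum_def by (simp add: two(1))
  have o: "obj T" "obj ?A'" "obj ?B" "obj ?B'"
    using seqD(1)[OF X] seqD(1)[OF Y] n3 unfolding T_def by simp_all
  have a: "snd X 1 \<in> hom (fst X 1) ?A'" using seqD(2)[OF X, of 1] two by simp
  have b: "snd Y n \<in> hom ?B (S ?B')" using seqD(3)[OF Y] by simp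
  have f: "\<phi> 1 \<in> hom (fst X 1) ?B'" using \<phi> two by (simp add: is_seqmor_def Let_def)
  have "?e 1 1 \<in> hom (two T ?B 1) (S (two ?A' ?B' 1))" "?e 1 2 \<in> hom (two T ?B 2) (S (two ?A' ?B' 1))"
    "?e 2 1 \<in> hom (two T ?B 1) (S (two ?A' ?B' 2))" "?e 2 2 \<in> hom (two T ?B 2) (S (two ?A' ?B' 2))"
    using a b f o unfolding T_def by (simp_all add: two_def hom_iff)
  note m = mat_2[OF is_dsum_dsum[OF o(1,3)] Sm_is_dsum[OF is_dsum_dsum[OF o(2,4)]] this, folded d pr1_def pr2_def]
  show "d \<in> hom (dsum T ?B) (S (dsum ?A' ?B'))" "Sm (pr1 ?A' ?B') \<cdot> d = \<boxminus> (Sm (snd X 1) \<cdot> pr1 T ?B)"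
    "Sm (pr2 ?A' ?B') \<cdot> d = Sm (\<phi> 1) \<cdot> pr1 T ?B \<boxplus> snd Y n \<cdot> pr2 T ?B"
    using m a b f o unfolding T_def by (simp_all add: hom_iff)
qed

text \<open>
  A sequence is continued by zero objects beyond n, so that the map leaving the n-th object splits in two:
  the map \<open>\<alpha> n\<close> into a zero object, and the closing map \<open>w\<close> into the shift of the first object.
\<close>

definition long where
  "long A \<alpha> w \<longleftrightarrow> (\<forall>k\<ge>1. obj (A k)) \<and> (\<forall>k>n. is_zero_obj C (A k))
    \<and> (\<forall>k\<ge>1. \<alpha> k \<in> hom (A k) (A (Suc k))) \<and> w \<in> hom (A n) (S (A 1))"

definition seq_of where
  "seq_of A \<alpha> w = (A, \<lambda>k. if k < n then \<alpha> k else w)"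

lemma longD:
  assumes "long A \<alpha> w"
  shows "1 \<le> k \<Longrightarrow> obj (A k)" "n < k \<Longrightarrow> is_zero_obj C (A k)"
    "1 \<le> k \<Longrightarrow> \<alpha> k \<in> hom (A k) (A (Suc k))" "w \<in> hom (A n) (S (A 1))"
  using assms by (simp_all add: long_def)

lemma seq_of_simps [simp]:
  "fst (seq_of A \<alpha> w) = A" "k < n \<Longrightarrow> snd (seq_of A \<alpha> w) k = \<alpha> k" "snd (seq_of A \<alpha> w) n = w"
  by (simp_all add: seq_of_def)

lemma is_seq_seq_of: "long A \<alpha> w \<Longrightarrow> is_seq C S n (seq_of A \<alpha> w)"
  by (simp add: is_seq_def Let_def long_def)

section \<open>The reduced cone of zero-extended sequences\<close>

definition reduced_obj where
  "reduced_obj A B k = (if k = 1 then A 2 else dsum (A (Suc k)) (B k))"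

text \<open>At k = n - 1 the \<alpha>-entry ends in a zero object, so the object at n is B_n up to
  isomorphism and the formula needs no separate case there.\<close>

definition reduced_map where
  "reduced_map A \<alpha> B \<beta> \<phi> k =
    (if k = 1 then in1 (A 3) (B 2) \<cdot> \<boxminus> (\<alpha> 2) \<boxplus> in2 (A 3) (B 2) \<cdot> \<phi> 2
     else in1 (A (Suc (Suc k))) (B (Suc k)) \<cdot> \<boxminus> (\<alpha> (Suc k) \<cdot> pr1 (A (Suc k)) (B k))
       \<boxplus> in2 (A (Suc (Suc k))) (B (Suc k)) \<cdot>
         (\<phi> (Suc k) \<cdot> pr1 (A (Suc k)) (B k) \<boxplus> \<beta> k \<cdot> pr2 (A (Suc k)) (B k)))"

definition reduced_last where
  "reduced_last A \<alpha> B w = Sm (\<alpha> 1) \<cdot> w \<cdot> pr2 (A (Suc n)) (B n)"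

definition long_mor where
  "long_mor A \<alpha> w B \<beta> w' \<phi> \<longleftrightarrow> (\<forall>k\<ge>1. \<phi> k \<in> hom (A k) (B k)) \<and>
    (\<forall>k\<ge>1. \<phi> (Suc k) \<cdot> \<alpha> k = \<beta> k \<cdot> \<phi> k) \<and> Sm (\<phi> 1) \<cdot> w = w' \<cdot> \<phi> n"

lemma long_morD:
  assumes "long_mor A \<alpha> w B \<beta> w' \<phi>"
  shows "1 \<le> k \<Longrightarrow> \<phi> k \<in> hom (A k) (B k)" "1 \<le> k \<Longrightarrow> \<phi> (Suc k) \<cdot> \<alpha> k = \<beta> k \<cdot> \<phi> k"
    "Sm (\<phi> 1) \<cdot> w = w' \<cdot> \<phi> n"
  using assms by (simp_all add: long_mor_def)

lemma is_seqmor_seq_of: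
  "long_mor A \<alpha> w B \<beta> w' \<phi> \<Longrightarrow> is_seqmor C Sm n (seq_of A \<alpha> w) (seq_of B \<beta> w') \<phi>"
  by (simp add: is_seqmor_def Let_def long_mor_def)

text \<open>The reduced cone has to be zero-extended again, since the construction is later applied
  to its own output.\<close>

lemma long_red:
  assumes A: "long A \<alpha> w" and B: "long B \<beta> w'" and \<phi>: "long_mor A \<alpha> w B \<beta> w' \<phi>" and AB: "B 1 = A 1"
  shows "long (reduced_obj A B) (reduced_map A \<alpha> B \<beta> \<phi>) (reduced_last A \<alpha> B w')"
  unfolding long_def
proof (intro conjI allI impI)
  have [simp]: "obj (A (Suc k))" "obj (B (Suc k))" for k
    using longD(1)[OF A, of "Suc k"] longD(1)[OF B, of "Suc k"] by simp_all
  have [simp]: "obj (A 2)" "obj (A 3)" "obj (B 2)"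
    using longD(1)[OF A, of 2] longD(1)[OF A, of 3] longD(1)[OF B, of 2] by simp_all
  fix k :: nat
  show "n < k \<Longrightarrow> is_zero_obj C (reduced_obj A B k)"
    using n3 longD(2)[OF A, of "Suc k"] longD(2)[OF B, of k] by (simp add: reduced_obj_def dsum_zero)
  show "reduced_last A \<alpha> B w' \<in> hom (reduced_obj A B n) (S (reduced_obj A B 1))"
    using longD(3)[OF A, of 1] longD(4)[OF B] longD(1)[OF B, of n] n3
    by (simp add: reduced_last_def reduced_obj_def hom_iff AB)
  assume k: "1 \<le> k"
  show "obj (reduced_obj A B k)" using k longD(1)[OF A, of "Suc k"] longD(1)[OF B, of k] by (simp add: reduced_obj_def)
  show "reduced_map A \<alpha> B \<beta> \<phi> k \<in> hom (reduced_obj A B k) (reduced_obj A B (Suc k))"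
  proof (cases "k = 1")
    case True
    then show ?thesis using longD(3)[OF A, of 2] long_morD(1)[OF \<phi>, of 2]
      by (simp add: reduced_map_def reduced_obj_def hom_iff)
  next
    case False
    then show ?thesis using k longD(3)[OF A, of "Suc k"] longD(3)[OF B, of k] long_morD(1)[OF \<phi>, of "Suc k"]
        longD(1)[OF B, of k]
      by (simp add: reduced_map_def reduced_obj_def hom_iff)
  qed
qed

lemma reduced_cone:
  assumes A: "long A \<alpha> w" and B: "long B \<beta> w'" and \<phi>: "long_mor A \<alpha> w B \<beta> w' \<phi>" and AB: "B 1 = A 1"
    and \<phi>1: "\<phi> 1 = one (A 1)"
    and AN: "seq_of A \<alpha> w \<in> N" and BN: "seq_of B \<beta> w' \<in> N"
    and cone: "cone C S Sm n (seq_of A \<alpha> w) (seq_of B \<beta> w') \<phi> \<in> N"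
  shows "seq_of (reduced_obj A B) (reduced_map A \<alpha> B \<beta> \<phi>) (reduced_last A \<alpha> B w') \<in> N" (is "?E \<in> N")
proof -
  let ?X = "seq_of A \<alpha> w" and ?Y = "seq_of B \<beta> w'"
  let ?K = "cone C S Sm n ?X ?Y \<phi>"
  \<comment> \<open>In matrix form \<open>i\<close> is [1; 0] at 1 and [-w'; 1] at n, while
    \<open>p\<close> is [1 \<alpha>_1] at 1 and [0 1] at n; in between both are identities. What
    disappears is A_1 at position 1 and its shift at position n.\<close>
  define i where "i k = (if k = 1 then in1 (A 2) (A 1) else if k < n then one (dsum (A (Suc k)) (B k))
    else in1 (S (A 1)) (B n) \<cdot> \<boxminus> (w' \<cdot> pr2 (A (Suc n)) (B n)) \<boxplus> in2 (S (A 1)) (B n) \<cdot> pr2 (A (Suc n)) (B n))" for k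
  define p where "p k = (if k = 1 then pr1 (A 2) (A 1) \<boxplus> \<alpha> 1 \<cdot> pr2 (A 2) (A 1)
    else if k < n then one (dsum (A (Suc k)) (B k)) else in2 (A (Suc n)) (B n) \<cdot> pr2 (S (A 1)) (B n))" for k
  note hom = longD(3)[OF A] longD(3)[OF B] longD(4)[OF A] longD(4)[OF B] long_morD(1)[OF \<phi>]
  have [simp]: "obj (A (Suc k))" "obj (B (Suc k))" for k
    using longD(1)[OF A, of "Suc k"] longD(1)[OF B, of "Suc k"] by simp_all
  have ob [simp]: "obj (A 1)" "obj (A 2)" "obj (A 3)" "obj (B 2)" "obj (B n)"
    using longD(1)[OF A, of 1] longD(1)[OF A, of 2] longD(1)[OF A, of 3] longD(1)[OF B, of 2]
      longD(1)[OF B, of n] n3 by simp_all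
  have n [simp]: "1 < n" "2 < n" "n \<noteq> 1" using n3 by simp_all
  \<comment> \<open>The map from position n - 1 needs separate care: its target in the cone contains
    \<open>S (A 1)\<close>, where the reduced cone has a zero object.\<close>
  obtain m where m: "Suc m = n" "2 \<le> m" "m < n" using n3 by (cases n) auto
  note E = is_seq_seq_of[OF long_red[OF A B \<phi> AB]]
  note sX = is_seq_seq_of[OF A] and sY = is_seq_seq_of[OF B] and mor = is_seqmor_seq_of[OF \<phi>]
  note K = cone_map[OF sX sY mor] and Kn = cone_map_last[OF sX sY mor]
  have aa: "\<alpha> 2 \<cdot> \<alpha> 1 = \<zero> (A 1) (A 3)" using comp_first[OF AN] by simp
  have bb: "w' \<cdot> \<beta> m = \<zero> (B m) (S (A 1))"
    using comp_consecutive[OF BN, of m] m longD(4)[OF B] seq_of_simps(3)[of B \<beta> w'] by (simp add: hom_iff AB)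
  have wf: "w' \<cdot> \<phi> n = w" using long_morD(3)[OF \<phi>] \<phi>1 longD(4)[OF A] by (simp add: hom_iff)
  have ff: "\<phi> 2 \<cdot> \<alpha> 1 = \<beta> 1" using long_morD(2)[OF \<phi>, of 1] \<phi>1 longD(3)[OF B, of 1] by (simp add: hom_iff AB)
  have first: "snd ?K 1 \<cdot> in1 (A 2) (A 1) = in1 (A 3) (B 2) \<cdot> \<boxminus> (\<alpha> 2) \<boxplus> in2 (A 3) (B 2) \<cdot> \<phi> 2"
    "(in1 (A 3) (B 2) \<cdot> \<boxminus> (\<alpha> 2) \<boxplus> in2 (A 3) (B 2) \<cdot> \<phi> 2) \<cdot> (pr1 (A 2) (A 1) \<boxplus> \<alpha> 1 \<cdot> pr2 (A 2) (A 1)) = snd ?K 1"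
    by (rule cone_first[of "\<alpha> 1" "A 1" "A 2" "\<alpha> 2" "A 3" "\<beta> 1" "B 2" "\<phi> 2" "snd ?K 1"];
      use hom(1)[of 1] hom(1)[of 2] hom(2)[of 1] hom(5)[of 2] K[of 1] aa ff AB in simp)+
  have middle: "snd ?K k = reduced_map A \<alpha> B \<beta> \<phi> k" if "2 \<le> k" "Suc k < n" for k
  proof -
    have "reduced_map A \<alpha> B \<beta> \<phi> k = in1 (A (Suc (Suc k))) (B (Suc k)) \<cdot> \<boxminus> (\<alpha> (Suc k) \<cdot> pr1 (A (Suc k)) (B k))
       \<boxplus> in2 (A (Suc (Suc k))) (B (Suc k)) \<cdot>
         (\<phi> (Suc k) \<cdot> pr1 (A (Suc k)) (B k) \<boxplus> \<beta> k \<cdot> pr2 (A (Suc k)) (B k))"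
      using that by (simp add: reduced_map_def)
    then show ?thesis
      by (rule ssubst) (rule cone_middle; use that K[of k] hom(1)[of "Suc k"] hom(2)[of k] hom(5)[of "Suc k"] in simp)
  qed
  have in_eq: "i n = in1 (S (A 1)) (B n) \<cdot> \<boxminus> (w' \<cdot> pr2 (A (Suc n)) (B n)) \<boxplus> in2 (S (A 1)) (B n) \<cdot> pr2 (A (Suc n)) (B n)"
    and pn_eq: "p n = in2 (A (Suc n)) (B n) \<cdot> pr2 (S (A 1)) (B n)"
    and i1_eq: "i 1 = in1 (A 2) (A 1)" and p1_eq: "p 1 = pr1 (A 2) (A 1) \<boxplus> \<alpha> 1 \<cdot> pr2 (A 2) (A 1)"
    and m_eq: "reduced_map A \<alpha> B \<beta> \<phi> m = in1 (A (Suc n)) (B n) \<cdot> \<boxminus> (\<alpha> n \<cdot> pr1 (A n) (B m))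
       \<boxplus> in2 (A (Suc n)) (B n) \<cdot> (\<phi> n \<cdot> pr1 (A n) (B m) \<boxplus> \<beta> m \<cdot> pr2 (A n) (B m))"
    using m by (simp_all add: i_def p_def reduced_map_def)
  have pen: "i n \<cdot> reduced_map A \<alpha> B \<beta> \<phi> m = snd ?K m" "p n \<cdot> snd ?K m = reduced_map A \<alpha> B \<beta> \<phi> m"
    "p n \<cdot> i n = one (dsum (A (Suc n)) (B n))"
    unfolding in_eq pn_eq m_eq
    by (rule cone_penultimate[of w "A n" "S (A 1)" "\<phi> n" "B n" "\<beta> m" "B m" w' "snd ?K m" "\<alpha> n" "A (Suc n)"];
      use hom(1)[of n] hom(2)[of m] hom(3,4) hom(5)[of n] K[of m] longD(2)[OF A, of "Suc n"] wf bb m AB in simp)+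
  have last: "Sm (i 1) \<cdot> reduced_last A \<alpha> B w' = snd ?K n \<cdot> i n" "Sm (p 1) \<cdot> snd ?K n = reduced_last A \<alpha> B w' \<cdot> p n"
    unfolding in_eq pn_eq i1_eq p1_eq reduced_last_def
    by (rule cone_last[of "\<alpha> 1" "A 1" "A 2" w' "B n" "snd ?K n" "A (Suc n)"];
      use hom(1)[of 1] hom(4) Kn \<phi>1 AB in simp)+
  have ip: "i k \<in> hom (reduced_obj A B k) (fst ?K k) \<and> p k \<in> hom (fst ?K k) (reduced_obj A B k)
    \<and> p k \<cdot> i k = one (reduced_obj A B k)" if k: "1 \<le> k" "k \<le> n" for k
  proof -
    consider "k = 1" | "1 < k" "k < n" | "k = n" using k by linarith
    then show ?thesis
    proof cases
      case 1
      then show ?thesis using hom(1)[of 1] by (simp add: i1_eq p1_eq reduced_obj_def cone_obj hom_iff AB)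
    next
      case 2
      then show ?thesis using longD(1)[OF B, of k] by (simp add: i_def p_def reduced_obj_def cone_obj hom_iff)
    next
      case 3
      then show ?thesis using hom(4) pen(3) by (simp add: in_eq pn_eq reduced_obj_def cone_obj hom_iff AB)
    qed
  qed
  have sq: "i (Suc k) \<cdot> reduced_map A \<alpha> B \<beta> \<phi> k = snd ?K k \<cdot> i k \<and> p (Suc k) \<cdot> snd ?K k = reduced_map A \<alpha> B \<beta> \<phi> k \<cdot> p k"
    if k: "1 \<le> k" "k < n" for k
  proof -
    consider "k = 1" | "2 \<le> k" "Suc k < n" | "k = m" using k m by linarith
    then show ?thesis
    proof cases
      case 1
      have "reduced_map A \<alpha> B \<beta> \<phi> 1 = in1 (A 3) (B 2) \<cdot> \<boxminus> (\<alpha> 2) \<boxplus> in2 (A 3) (B 2) \<cdot> \<phi> 2" by (simp add: reduced_map_def)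
      moreover have "i 2 = one (dsum (A 3) (B 2))" "p 2 = one (dsum (A 3) (B 2))" by (simp_all add: i_def p_def)
      moreover have "snd ?K 1 \<in> hom (dsum (A 2) (A 1)) (dsum (A 3) (B 2))" using K(1)[of 1] AB by simp
      ultimately show ?thesis using 1 first hom(1)[of 2] hom(5)[of 2] by (simp add: i1_eq p1_eq hom_iff)
    next
      case 2
      then have "reduced_map A \<alpha> B \<beta> \<phi> k \<in> hom (dsum (A (Suc k)) (B k)) (dsum (A (Suc (Suc k))) (B (Suc k)))"
        using K(1)[of k] middle[of k] by simp
      then show ?thesis using 2 middle[of k] by (simp add: i_def p_def hom_iff)
    next
      case 3
      have "i m = one (dsum (A n) (B m))" "p m = one (dsum (A n) (B m))" using m by (simp_all add: i_def p_def)
      moreover have "snd ?K m \<in> hom (dsum (A n) (B m)) (dsum (S (A 1)) (B n))" using K(1)[of m] m by simp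
      moreover have "reduced_map A \<alpha> B \<beta> \<phi> m \<in> hom (dsum (A n) (B m)) (dsum (A (Suc n)) (B n))"
        using longD(3)[OF long_red[OF A B \<phi> AB], of m] m by (simp add: reduced_obj_def)
      ultimately show ?thesis using 3 m pen by (simp add: hom_iff)
    qed
  qed
  show ?thesis
  proof (rule summand[OF E cone, of i p])
    show "is_seqmor C Sm n ?E ?K i" "is_seqmor C Sm n ?K ?E p"
      unfolding is_seqmor_def Let_def using ip sq last by simp_all
  qed (use ip in simp)
qed

lemma ex_reduced_cone:
  assumes A: "long A \<alpha> w" and B: "long B \<beta> w'" and AB: "B 1 = A 1"
    and AN: "seq_of A \<alpha> w \<in> N" and BN: "seq_of B \<beta> w' \<in> N"
    and f: "f \<in> hom (A 2) (B 2)" "f \<cdot> \<alpha> 1 = \<beta> 1"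
  obtains \<phi> where "long_mor A \<alpha> w B \<beta> w' \<phi>" "\<phi> 1 = one (A 1)" "\<phi> 2 = f"
    "seq_of (reduced_obj A B) (reduced_map A \<alpha> B \<beta> \<phi>) (reduced_last A \<alpha> B w') \<in> N"
proof -
  have n: "1 < n" "2 < n" "Suc 0 \<le> n" using n3 by simp_all
  have "\<exists>\<phi>. \<phi> 1 = one (A 1) \<and> \<phi> 2 = f \<and> is_seqmor C Sm n (seq_of A \<alpha> w) (seq_of B \<beta> w') \<phi>
      \<and> cone C S Sm n (seq_of A \<alpha> w) (seq_of B \<beta> w') \<phi> \<in> N"
    using N4[unfolded N4_def, rule_format, OF AN BN, of "one (A 1)" f] f AB n longD(1)[OF A, of 1] longD(3)[OF B, of 1]
    by (simp add: hom_iff)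
  then obtain \<phi>0 where \<phi>0: "\<phi>0 1 = one (A 1)" "\<phi>0 2 = f" "is_seqmor C Sm n (seq_of A \<alpha> w) (seq_of B \<beta> w') \<phi>0"
      "cone C S Sm n (seq_of A \<alpha> w) (seq_of B \<beta> w') \<phi>0 \<in> N" by blast
  \<comment> \<open>(N4) determines the components on 1 to n only. Zero values beyond n give a
    morphism of zero-extended sequences and do not change the cone on the relevant indices.\<close>
  define \<phi> where "\<phi> k = (if k \<le> n then \<phi>0 k else \<zero> (A k) (B k))" for k
  note D = seqmorD[OF \<phi>0(3)]
  have hom: "\<phi> k \<in> hom (A k) (B k)" if "1 \<le> k" for k
    using D(1)[of k] that longD(1)[OF A, of k] longD(1)[OF B, of k] by (simp add: \<phi>_def zero_hom)
  have "\<phi> (Suc k) \<cdot> \<alpha> k = \<beta> k \<cdot> \<phi> k" if k: "1 \<le> k" for k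
  proof (cases "k < n")
    case True
    then show ?thesis using D(2)[of k] k by (simp add: \<phi>_def)
  next
    case False
    then have z: "is_zero_obj C (B (Suc k))" using longD(2)[OF B] by simp
    have "\<phi> (Suc k) \<cdot> \<alpha> k \<in> hom (A k) (B (Suc k))" "\<beta> k \<cdot> \<phi> k \<in> hom (A k) (B (Suc k))"
      using hom[of k] hom[of "Suc k"] longD(3)[OF A k] longD(3)[OF B k] k by (simp_all add: hom_iff)
    then show ?thesis using to_zero_obj[OF z] by metis
  qed
  then have mor: "long_mor A \<alpha> w B \<beta> w' \<phi>"
    unfolding long_mor_def using hom D(3) n by (simp add: \<phi>_def)
  have "cone C S Sm n (seq_of A \<alpha> w) (seq_of B \<beta> w') \<phi> \<in> N"
    by (rule seq_cong[OF \<phi>0(4)]) (use n in \<open>simp_all add: cone_def Let_def \<phi>_def cong: if_cong\<close>)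
  from reduced_cone[OF A B mor AB _ AN BN this] that[OF mor] \<phi>0 n show thesis by (simp add: \<phi>_def)
qed

section \<open>Extension of a given n-angle by zero objects\<close>

definition ext_obj where "ext_obj X k = (if k \<le> n then fst X k else zob C)"
definition ext_map where "ext_map X k = (if k < n then snd X k else \<zero> (ext_obj X k) (ext_obj X (Suc k)))"

lemma obj_ext_obj: "X \<in> N \<Longrightarrow> 1 \<le> k \<Longrightarrow> obj (ext_obj X k)"
  using N_seq seqD(1)[of X k] by (simp add: ext_obj_def)

lemma long_ext:
  assumes "X \<in> N" shows "long (ext_obj X) (ext_map X) (snd X n)"
proof -
  note D = seqD[OF N_seq[rule_format, OF assms]]
  show ?thesis
    unfolding long_def
  proof (intro conjI allI impI)
    fix k :: nat assume k: "1 \<le> k"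
    show "ext_map X k \<in> hom (ext_obj X k) (ext_obj X (Suc k))"
      using D(2)[of k] k obj_ext_obj[OF assms, of k] obj_ext_obj[OF assms, of "Suc k"]
      by (simp add: ext_map_def zero_hom) (simp add: ext_obj_def)
  qed (use D(3) n3 obj_ext_obj[OF assms] is_zero_obj_zob in \<open>simp_all add: ext_obj_def\<close>)
qed

lemma seq_of_ext: "X \<in> N \<Longrightarrow> seq_of (ext_obj X) (ext_map X) (snd X n) \<in> N"
  by (erule seq_cong) (simp_all add: seq_of_def ext_obj_def ext_map_def)

lemma ext_map_comp:
  assumes "X \<in> N" "1 \<le> k"
  shows "ext_map X (Suc k) \<cdot> ext_map X k = \<zero> (ext_obj X k) (ext_obj X (Suc (Suc k)))"
proof (cases "Suc k < n")
  case True
  then have "snd X (Suc k) \<in> hom (fst X (Suc k)) (fst X (Suc (Suc k)))"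
    using seqD(2)[of X "Suc k"] N_seq assms by simp
  then show ?thesis using True comp_consecutive[OF assms] by (simp add: ext_map_def ext_obj_def hom_iff)
next
  case False
  have "ext_map X (Suc k) \<cdot> ext_map X k \<in> hom (ext_obj X k) (ext_obj X (Suc (Suc k)))"
    using longD(3)[OF long_ext[OF assms(1)], of k] longD(3)[OF long_ext[OF assms(1)], of "Suc k"] assms(2)
    by (simp add: hom_iff)
  moreover have "is_zero_obj C (ext_obj X (Suc (Suc k)))" using False is_zero_obj_zob by (simp add: ext_obj_def)
  ultimately show ?thesis by (rule to_zero_obj[rotated])
qed

section \<open>Coordinates of the sequence D\<close>

definition third_obj where "third_obj Z k = (if 3 \<le> k \<and> k \<le> n then fst Z k else zob C)"
text \<open>The summands are listed exactly as in \<open>Dseq\<close>, so that both choose the same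
  direct sum and the objects are equal, not just isomorphic.\<close>

definition Dsum where "Dsum X Y Z k = dsdata C 3 (three (ext_obj X (Suc (Suc k))) (ext_obj Y (Suc k)) (third_obj Z k))"
definition Dobj where "Dobj X Y Z k = fst (Dsum X Y Z k)"
definition Dinj where "Dinj X Y Z k = fst (snd (Dsum X Y Z k))"
definition Dproj where "Dproj X Y Z k = snd (snd (Dsum X Y Z k))"

lemma obj_third_obj: "Z \<in> N \<Longrightarrow> obj (third_obj Z k)"
  using N_seq seqD(1)[of Z k] by (simp add: third_obj_def)

lemma is_dsum_D:
  assumes "X \<in> N" "Y \<in> N" "Z \<in> N"
  shows "is_dsum C 3 (three (ext_obj X (Suc (Suc k))) (ext_obj Y (Suc k)) (third_obj Z k))
    (Dobj X Y Z k) (Dinj X Y Z k) (Dproj X Y Z k)"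
  unfolding Dobj_def Dinj_def Dproj_def Dsum_def
  by (rule is_dsum_dsdata[OF ex_dsum_3]) (use assms obj_ext_obj obj_third_obj in simp_all)

lemma Dseq_obj: "fst (Dseq C S Sm n X Y Z \<phi> \<psi>) k = (if k = 1 then fst X 3 else Dobj X Y Z k)"
  by (simp add: Dseq_def Let_def Dobj_def Dsum_def third_obj_def ext_obj_def flip: Suc_eq_plus1)

lemma Dseq_first:
  "snd (Dseq C S Sm n X Y Z \<phi> \<psi>) 1 = Dinj X Y Z 2 1 \<cdot> ext_map X 3 \<boxplus> Dinj X Y Z 2 2 \<cdot> \<phi> 3"
proof -
  have "ext_map X 3 = (if 4 \<le> n then snd X 3 else \<zero> (fst X 3) (if 4 \<le> n then fst X 4 else zob C))"
    using n3 by (auto simp: ext_map_def ext_obj_def)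
  then show ?thesis using n3 by (simp add: Dseq_def Let_def Dinj_def Dsum_def third_obj_def ext_obj_def)
qed

lemma Dseq_last: "snd (Dseq C S Sm n X Y Z \<phi> \<psi>) n = Sm (snd X 2) \<cdot> snd Z n \<cdot> Dproj X Y Z n 3"
  using n3 by (simp add: Dseq_def Let_def Dproj_def Dsum_def third_obj_def ext_obj_def flip: Suc_eq_plus1)

text \<open>The index \<open>j\<close> follows the notation d_{j+1} and is one less than the
  position. \<open>Dseq\<close> replaces entries by zero maps once an index passes n. There the
  extended maps start or end at a zero object and vanish too, so the upper bounds disappear; the
  exception at j = 1 stays, as C_2 counts as zero in D.\<close>

lemma Dseq_middle:
  fixes X Y Z \<phi> \<psi> j
  assumes N: "X \<in> N" "Y \<in> N" "Z \<in> N" and j: "1 \<le> j" "Suc j < n"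
    and \<phi>: "\<phi> (j + 3) \<in> hom (ext_obj X (j + 3)) (ext_obj Y (j + 3))"
    and \<psi>: "\<psi> (2 * j) \<in> hom (ext_obj X (j + 3)) (fst Z (j + 2))"
      "\<psi> (2 * j - 1) \<in> hom (ext_obj Y (j + 2)) (fst Z (j + 2))"
  defines "Q \<equiv> Dproj X Y Z (j + 1)" and "Q' \<equiv> Dproj X Y Z (j + 2)"
    and "d \<equiv> snd (Dseq C S Sm n X Y Z \<phi> \<psi>) (j + 1)"
  shows "d \<in> hom (Dobj X Y Z (j + 1)) (Dobj X Y Z (j + 2))"
    "Q' 1 \<cdot> d = \<boxminus> (ext_map X (j + 3) \<cdot> Q 1)"
    "Q' 2 \<cdot> d = sgnm C (j + 1) (\<phi> (j + 3)) \<cdot> Q 1 \<boxplus> \<boxminus> (ext_map Y (j + 2) \<cdot> Q 2)"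
    "Q' 3 \<cdot> d = \<psi> (2 * j) \<cdot> Q 1 \<boxplus> \<psi> (2 * j - 1) \<cdot> Q 2
      \<boxplus> (if 2 \<le> j then ext_map Z (j + 1) else \<zero> (zob C) (fst Z (j + 2))) \<cdot> Q 3"
proof -
  let ?A = "ext_obj X" and ?B = "ext_obj Y" and ?C = "third_obj Z"
  let ?X = "\<lambda>k. three (?A (k + 2)) (?B (k + 1)) (?C k)"
  let ?e = "\<lambda>(r::nat) (c::nat). if r = 1 \<and> c = 1 then (if j + 4 \<le> n then negm C (snd X (j + 3)) else zerm C (?A (j + 3)) (?A (j + 4)))
        else if r = 2 \<and> c = 1 then (if j + 3 \<le> n then sgnm C (j + 1) (\<phi> (j + 3)) else zerm C (?A (j + 3)) (?B (j + 3)))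
        else if r = 2 \<and> c = 2 then (if j + 3 \<le> n then negm C (snd Y (j + 2)) else zerm C (?B (j + 2)) (?B (j + 3)))
        else if r = 3 \<and> c = 1 then (if j + 3 \<le> n then \<psi> (2 * j) else zerm C (?A (j + 3)) (?C (j + 2)))
        else if r = 3 \<and> c = 2 then \<psi> (2 * j - 1)
        else if r = 3 \<and> c = 3 then (if 2 \<le> j then snd Z (j + 1) else zerm C (?C (j + 1)) (?C (j + 2)))
        else zerm C (?X (j + 1) c) (?X (j + 2) r)"
  have ar: "2 + 1 = (3::nat)" "1 + 2 = (3::nat)" "2 + 2 = (4::nat)" "1 + 3 = (4::nat)" by simp_all
  have "j + 1 \<noteq> 1" "j + 1 < n" "Suc (j + 1) = j + 2" "j + 1 - 1 = j" using j by simp_all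
  then have d: "d = mat C 3 (Dobj X Y Z (j + 1)) (Dobj X Y Z (j + 2)) (Dinj X Y Z (j + 2)) Q ?e"
    unfolding d_def Q_def Dseq_def Let_def Dobj_def Dinj_def Dproj_def Dsum_def third_obj_def ext_obj_def
      snd_conv Suc_eq_plus1 add.assoc one_add_one
    by (simp only: if_False if_True ar)
  have C: "?C (j + 2) = fst Z (j + 2)" using j by (simp add: third_obj_def)
  have C1: "?C (j + 1) = (if 2 \<le> j then fst Z (j + 1) else zob C)" using j by (auto simp: third_obj_def)
  note [simp del] = add_2_eq_Suc'
  have o [simp]: "obj (?A (j + 3))" "obj (?A (j + 4))" "obj (?B (j + 2))" "obj (?B (j + 3))"
    "obj (?C (j + 1))" "obj (fst Z (j + 2))"
    using obj_ext_obj N obj_third_obj[OF N(3), of "j + 2", unfolded C] by (simp_all add: obj_third_obj)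
  have S: "Suc (Suc (j + 1)) = j + 3" "Suc (Suc (j + 2)) = j + 4" "Suc (j + 1) = j + 2" "Suc (j + 2) = j + 3" "Suc (j + 3) = j + 4" by simp_all
  have hom: "ext_map X (j + 3) \<in> hom (?A (j + 3)) (?A (j + 4))" "ext_map Y (j + 2) \<in> hom (?B (j + 2)) (?B (j + 3))"
    using longD(3)[OF long_ext[OF N(1)], of "j + 3", unfolded S]
      longD(3)[OF long_ext[OF N(2)], of "j + 2", unfolded S] by simp_all
  have homZ: "(if 2 \<le> j then ext_map Z (j + 1) else \<zero> (zob C) (fst Z (j + 2))) \<in> hom (?C (j + 1)) (fst Z (j + 2))"
    using longD(3)[OF long_ext[OF N(3)], of "j + 1", unfolded S] j unfolding C1
    by (auto simp: ext_obj_def zero_hom o)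
  have e11: "?e 1 1 = \<boxminus> (ext_map X (j + 3))"
    using o(1,2) by (auto simp: ext_map_def S)
  have e22: "?e 2 2 = \<boxminus> (ext_map Y (j + 2))"
    using o(3,4) by (auto simp: ext_map_def S)
  have e33: "?e 3 3 = (if 2 \<le> j then ext_map Z (j + 1) else \<zero> (zob C) (fst Z (j + 2)))"
    using j by (auto simp: ext_map_def C C1)
  have e21: "?e 2 1 = sgnm C (j + 1) (\<phi> (j + 3))"
  proof (cases "j + 3 \<le> n")
    case False
    then have "\<phi> (j + 3) = \<zero> (?A (j + 3)) (?B (j + 3))"
      using to_zero_obj[OF is_zero_obj_zob] \<phi> by (simp add: ext_obj_def)
    then show ?thesis using False by (simp add: sgnm_def)
  qed simp
  have e31: "?e 3 1 = \<psi> (2 * j)"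
  proof (cases "j + 3 \<le> n")
    case False
    then have "\<psi> (2 * j) = \<zero> (?A (j + 3)) (fst Z (j + 2))"
      using from_zero_obj[OF is_zero_obj_zob] \<psi>(1) by (simp add: ext_obj_def)
    then show ?thesis using False C by simp
  qed simp
  have e32: "?e 3 2 = \<psi> (2 * j - 1)" by simp
  have e0: "?e 1 2 = \<zero> (?B (j + 2)) (?A (j + 4))" "?e 1 3 = \<zero> (?C (j + 1)) (?A (j + 4))"
    "?e 2 3 = \<zero> (?C (j + 1)) (?B (j + 3))"
    by (simp_all add: three_def add.assoc)
  define e where "e = ?e"
  have d': "d = mat C 3 (Dobj X Y Z (j + 1)) (Dobj X Y Z (j + 2)) (Dinj X Y Z (j + 2)) Q e"
    unfolding e_def by (rule d)
  have e: "e 1 1 = \<boxminus> (ext_map X (j + 3))" "e 1 2 = \<zero> (?B (j + 2)) (?A (j + 4))" "e 1 3 = \<zero> (?C (j + 1)) (?A (j + 4))"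
      "e 2 1 = sgnm C (j + 1) (\<phi> (j + 3))" "e 2 2 = \<boxminus> (ext_map Y (j + 2))" "e 2 3 = \<zero> (?C (j + 1)) (?B (j + 3))"
      "e 3 1 = \<psi> (2 * j)" "e 3 2 = \<psi> (2 * j - 1)"
      "e 3 3 = (if 2 \<le> j then ext_map Z (j + 1) else \<zero> (zob C) (fst Z (j + 2)))"
    unfolding e_def by (rule e11 e0(1) e0(2) e21 e22 e0(3) e31 e32 e33)+
  note P = is_dsum_D[OF N, of "j + 1", unfolded S, folded Q_def]
    and P' = is_dsum_D[OF N, of "j + 2", unfolded S C, folded Q'_def]
  let ?T = "three (?A (j + 3)) (?B (j + 2)) (?C (j + 1))" and ?T' = "three (?A (j + 4)) (?B (j + 3)) (fst Z (j + 2))"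
  have T: "?T 1 = ?A (j + 3)" "?T 2 = ?B (j + 2)" "?T 3 = ?C (j + 1)"
     "?T' 1 = ?A (j + 4)" "?T' 2 = ?B (j + 3)" "?T' 3 = fst Z (j + 2)" by (simp_all add: three_def)
  have eh: "e 1 1 \<in> hom (?T 1) (?T' 1)" "e 1 2 \<in> hom (?T 2) (?T' 1)" "e 1 3 \<in> hom (?T 3) (?T' 1)"
    "e 2 1 \<in> hom (?T 1) (?T' 2)" "e 2 2 \<in> hom (?T 2) (?T' 2)" "e 2 3 \<in> hom (?T 3) (?T' 2)"
    "e 3 1 \<in> hom (?T 1) (?T' 3)" "e 3 2 \<in> hom (?T 2) (?T' 3)" "e 3 3 \<in> hom (?T 3) (?T' 3)"
    unfolding e T using hom homZ \<phi> \<psi> by (simp_all add: hom_iff)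
  note m = mat_3[where e=e, OF P P' eh, folded d', unfolded e]
  show "d \<in> hom (Dobj X Y Z (j + 1)) (Dobj X Y Z (j + 2))" by (rule m)
  have Q: "arr (Q 1)" "cod (Q 1) = ?A (j + 3)" "arr (Q 2)" "cod (Q 2) = ?B (j + 2)" "arr (Q 3)" "cod (Q 3) = ?C (j + 1)"
    "obj (Dobj X Y Z (j + 1))" "dom (Q 1) = Dobj X Y Z (j + 1)" "dom (Q 2) = Dobj X Y Z (j + 1)" "dom (Q 3) = Dobj X Y Z (j + 1)"
    using P[unfolded is_dsum_3_iff T hom_iff] by simp_all
  show "Q' 1 \<cdot> d = \<boxminus> (ext_map X (j + 3) \<cdot> Q 1)"
    "Q' 2 \<cdot> d = sgnm C (j + 1) (\<phi> (j + 3)) \<cdot> Q 1 \<boxplus> \<boxminus> (ext_map Y (j + 2) \<cdot> Q 2)"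
    unfolding m using hom \<phi> Q by (simp_all add: hom_iff)
  show "Q' 3 \<cdot> d = \<psi> (2 * j) \<cdot> Q 1 \<boxplus> \<psi> (2 * j - 1) \<cdot> Q 2
      \<boxplus> (if 2 \<le> j then ext_map Z (j + 1) else \<zero> (zob C) (fst Z (j + 2))) \<cdot> Q 3" by (rule m)
qed

section \<open>Assembling the sequence D\<close>

lemma N4star: "N4star C S Sm n N"
  unfolding N4star_def
proof (intro ballI allI impI)
  fix X Y Z f
  assume XN: "X \<in> N" and YN: "Y \<in> N" and ZN: "Z \<in> N"
    and "fst Y 1 = fst X 1 \<and> fst Z 1 = fst X 2 \<and> fst Z 2 = fst Y 2 \<and> snd Z 1 = f \<and> f \<cdot> snd X 1 = snd Y 1"
  then have eqs: "fst Y 1 = fst X 1" "fst Z 1 = fst X 2" "fst Z 2 = fst Y 2" "snd Z 1 = f" "f \<cdot> snd X 1 = snd Y 1"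
    by simp_all
  have n: "1 < n" "2 < n" "1 \<le> n" "2 \<le> n" "n \<noteq> 1" "\<not> n < 3" using n3 by simp_all
  define A \<alpha> B \<beta> G \<gamma> where defs: "A = ext_obj X" "\<alpha> = ext_map X" "B = ext_obj Y" "\<beta> = ext_map Y" "G = ext_obj Z" "\<gamma> = ext_map Z"
  have le: "A k = fst X k" "B k = fst Y k" "G k = fst Z k" if "k \<le> n" for k
    using that by (simp_all add: defs ext_obj_def)
  have lt: "\<alpha> k = snd X k" "\<beta> k = snd Y k" "\<gamma> k = snd Z k" if "k < n" for k
    using that by (simp_all add: defs ext_map_def)
  have LA: "long A \<alpha> (snd X n)" and LB: "long B \<beta> (snd Y n)" and LG: "long G \<gamma> (snd Z n)"
    unfolding defs by (rule long_ext XN YN ZN)+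
  have AN: "seq_of A \<alpha> (snd X n) \<in> N" and BN: "seq_of B \<beta> (snd Y n) \<in> N" and GN: "seq_of G \<gamma> (snd Z n) \<in> N"
    unfolding defs by (rule seq_of_ext XN YN ZN)+
  have [simp]: "obj (A (Suc k))" "obj (B (Suc k))" "obj (G (Suc k))" for k
    using longD(1)[OF LA, of "Suc k"] longD(1)[OF LB, of "Suc k"] longD(1)[OF LG, of "Suc k"] by simp_all
  have ob [simp]: "obj (A 1)" "obj (A 2)" "obj (A 3)" "obj (B 2)" "obj (B n)" "obj (G 2)" "obj (G 3)" "obj (B 3)" "obj (A 4)"
    using longD(1)[OF LA, of 1] longD(1)[OF LA, of 2] longD(1)[OF LA, of 3] longD(1)[OF LB, of 2]
      longD(1)[OF LB, of n] longD(1)[OF LG, of 2] longD(1)[OF LG, of 3]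
      longD(1)[OF LB, of 3] longD(1)[OF LA, of 4] n3 by simp_all
  have BA: "B 1 = A 1" and GA: "G 1 = A 2" and GB: "G 2 = B 2" and g1: "\<gamma> 1 = f" and fab: "f \<cdot> \<alpha> 1 = \<beta> 1"
    using n eqs by (simp_all add: le lt)
  have fh: "f \<in> hom (A 2) (B 2)" using longD(3)[OF LG, of 1] g1 GA GB by simp
  obtain \<phi> where \<phi>: "long_mor A \<alpha> (snd X n) B \<beta> (snd Y n) \<phi>" "\<phi> 1 = one (A 1)" "\<phi> 2 = f"
    "seq_of (reduced_obj A B) (reduced_map A \<alpha> B \<beta> \<phi>) (reduced_last A \<alpha> B (snd Y n)) \<in> N"
    by (rule ex_reduced_cone[OF LA LB BA AN BN fh fab])
  define E e v where Edefs: "E = reduced_obj A B" "e = reduced_map A \<alpha> B \<beta> \<phi>" "v = reduced_last A \<alpha> B (snd Y n)"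
  have LE: "long E e v" unfolding Edefs by (rule long_red[OF LA LB \<phi>(1) BA])
  have EN: "seq_of E e v \<in> N" unfolding Edefs by (rule \<phi>)
  have E1: "E 1 = A 2" and E2: "E 2 = dsum (A 3) (B 2)" and Ek: "\<And>k. 2 \<le> k \<Longrightarrow> E k = dsum (A (Suc k)) (B k)"
    by (simp_all add: Edefs reduced_obj_def)
  have e1: "e 1 = in1 (A 3) (B 2) \<cdot> \<boxminus> (\<alpha> 2) \<boxplus> in2 (A 3) (B 2) \<cdot> f" using \<phi>(3) by (simp add: Edefs reduced_map_def)
  have a2: "\<alpha> 2 \<in> hom (A 2) (A 3)" using longD(3)[OF LA, of 2] by simp
  \<comment> \<open>The first map of E is the column [-\<alpha>_2; \<phi>_2], so [0 1] after it is
    \<phi>_2 = \<gamma>_1. This is the square that (N4) requires for (1, [0 1]).\<close>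
  have pe: "pr2 (A 3) (B 2) \<cdot> e 1 = \<gamma> 1" unfolding e1 g1 using a2 fh by (simp add: hom_iff)
  have ph: "pr2 (A 3) (B 2) \<in> hom (E 2) (G 2)" unfolding E2 GB by (simp add: hom_iff)
  have GE: "G 1 = E 1" using GA E1 by simp
  obtain \<theta> where \<theta>: "long_mor E e v G \<gamma> (snd Z n) \<theta>" "\<theta> 1 = one (E 1)" "\<theta> 2 = pr2 (A 3) (B 2)"
    "seq_of (reduced_obj E G) (reduced_map E e G \<gamma> \<theta>) (reduced_last E e G (snd Z n)) \<in> N"
    by (rule ex_reduced_cone[OF LE LG GE EN GN ph pe])
  let ?F = "seq_of (reduced_obj E G) (reduced_map E e G \<gamma> \<theta>) (reduced_last E e G (snd Z n))"
  have \<theta>h: "\<theta> k \<in> hom (dsum (A (Suc k)) (B k)) (G k)" if "2 \<le> k" for k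
    using long_morD(1)[OF \<theta>(1), of k] that by (simp add: Ek)
  \<comment> \<open>Both m = 2j - 1 and m = 2j give \<open>(m + 5) div 2\<close> = j + 2: the two
    maps are the B- and A-components of the same \<theta>_{j+2}. For even m the sign exponent
    \<open>m div 2\<close> is j, of the same parity as the exponent j + 2 at position j + 1 of
    D.\<close>
  define \<psi> where "\<psi> m = (let k = (m + 5) div 2 in if odd m then \<theta> k \<cdot> in2 (A (Suc k)) (B k)
    else sgnm C (m div 2) (\<theta> k \<cdot> in1 (A (Suc k)) (B k)))" for m
  have \<psi>: "\<psi> (2 * j - 1) = \<theta> (j + 2) \<cdot> in2 (A (j + 3)) (B (j + 2))"
    "\<psi> (2 * j) = sgnm C j (\<theta> (j + 2) \<cdot> in1 (A (j + 3)) (B (j + 2)))" if j: "1 \<le> j" for j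
  proof -
    have "(2 * j - 1 + 5) div 2 = j + 2" "odd (2 * j - 1)" "(2 * j + 5) div 2 = j + 2" "Suc (j + 2) = j + 3"
      "even (2 * j)" "2 * j div 2 = j"
      using j by presburger+
    then show "\<psi> (2 * j - 1) = \<theta> (j + 2) \<cdot> in2 (A (j + 3)) (B (j + 2))"
      "\<psi> (2 * j) = sgnm C j (\<theta> (j + 2) \<cdot> in1 (A (j + 3)) (B (j + 2)))"
      unfolding \<psi>_def Let_def by (simp_all only: if_True if_False not_True_eq_False not_False_eq_True)
  qed
  have \<psi>h: "\<psi> (2 * j - 1) \<in> hom (B (j + 2)) (G (j + 2))" "\<psi> (2 * j) \<in> hom (A (j + 3)) (G (j + 2))" if j: "1 \<le> j" for j
  proof -
    have "Suc (j + 2) = j + 3" by simp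
    moreover have "obj (A (j + 3))" "obj (B (j + 2))" using longD(1)[OF LA] longD(1)[OF LB] by simp_all
    ultimately show "\<psi> (2 * j - 1) \<in> hom (B (j + 2)) (G (j + 2))" "\<psi> (2 * j) \<in> hom (A (j + 3)) (G (j + 2))"
      unfolding \<psi>[OF j] using \<theta>h[of "j + 2"] by (simp_all only:) (simp_all add: hom_iff)
  qed
  let ?D = "Dseq C S Sm n X Y Z \<phi> \<psi>"
  have mor: "is_seqmor C Sm n X Y \<phi>"
    unfolding is_seqmor_def Let_def
  proof (intro conjI ballI)
    show "\<phi> k \<in> hom (fst X k) (fst Y k)" if "k \<in> {1..n}" for k
      using long_morD(1)[OF \<phi>(1), of k] that by (simp add: le)
    show "\<phi> (Suc k) \<cdot> snd X k = snd Y k \<cdot> \<phi> k" if "k \<in> {1..<n}" for k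
      using long_morD(2)[OF \<phi>(1), of k] that by (simp add: lt)
  qed (rule long_morD(3)[OF \<phi>(1)])
  have last: "snd Z n \<cdot> \<psi> (2 * n - 5) = Sm (snd X 1) \<cdot> snd Y n"
  proof -
    \<comment> \<open>Condition (2) is the closing square of \<theta> restricted to B_n. The index
      2n - 5 is the odd one for j = n - 2, so it denotes the B-component of \<theta>_n.\<close>
    have i: "2 * n - 5 = 2 * (n - 2) - 1" "1 \<le> n - 2" "n - 2 + 2 = n" "n - 2 + 3 = Suc n" using n3 by simp_all
    have "snd Z n \<cdot> \<psi> (2 * n - 5) = snd Z n \<cdot> \<theta> n \<cdot> in2 (A (Suc n)) (B n)"
      unfolding i(1) \<psi>(1)[OF i(2)] unfolding i ..
    also have "snd Z n \<cdot> \<theta> n = v"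
      using long_morD(3)[OF \<theta>(1)] \<theta>(2) longD(4)[OF LE] longD(1)[OF LE, of 1] by (simp add: hom_iff)
    then have "snd Z n \<cdot> \<theta> n \<cdot> in2 (A (Suc n)) (B n) = v \<cdot> in2 (A (Suc n)) (B n)"
      by (rule comp_reduce) (use longD(4)[OF LG] \<theta>h[of n] n in \<open>simp_all add: hom_iff\<close>)
    also have "\<dots> = Sm (snd X 1) \<cdot> snd Y n"
      using longD(4)[OF LB] longD(3)[OF LA, of 1] n BA by (simp add: Edefs reduced_last_def hom_iff lt)
    finally show ?thesis .
  qed
  have "?D \<in> N"
  proof -
    let ?P = "Dobj X Y Z" and ?J = "Dinj X Y Z" and ?Q = "Dproj X Y Z"
    \<comment> \<open>At position 2 the third summand C_2 = B_2 of the iterated cone gives way to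
      the zero object. The eliminated column of the first map is (0, -\<beta>_2, 1), so clearing it
      adds \<beta>_2 times the third coordinate to the second one. This is the value of
      \<open>t\<close> at 2.\<close>
    define g where "g k = (if k = 2 then \<zero> (zob C) (G 2) else one (G k))" for k
    define h where "h k = (if k = 2 then \<zero> (G 2) (zob C) else one (G k))" for k
    define t where "t k = (if k = 2 then \<beta> 2 else \<zero> (G k) (B (Suc k)))" for k
    define i where "i k = (if k = 1 then \<boxminus> (in1 (A 3) (B 2))
      else incl (A (Suc (Suc k))) (B (Suc k)) (G k) k (g k) (?Q k))" for k
    define p where "p k = (if k = 1 then \<boxminus> (pr1 (A 3) (B 2))
      else retr (A (Suc (Suc k))) (B (Suc k)) (G k) k (t k) (h k) (?J k))" for k
    have P: "is_dsum C 3 (three (A (Suc (Suc k))) (B (Suc k)) (third_obj Z k)) (?P k) (?J k) (?Q k)" for k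
      unfolding defs by (rule is_dsum_D[OF XN YN ZN])
    have third_obj: "third_obj Z k = (if k = 2 then zob C else G k)" if "2 \<le> k" "k \<le> n" for k
      using that by (auto simp: third_obj_def le)
    have F1: "reduced_obj E G 1 = dsum (A 3) (B 2)" by (simp add: reduced_obj_def E2)
    have Fk: "reduced_obj E G k = dsum (dsum (A (Suc (Suc k))) (B (Suc k))) (G k)" if "2 \<le> k" for k
      using that by (simp add: reduced_obj_def Ek)
    have b2: "\<beta> 2 \<in> hom (G 2) (B 3)" using longD(3)[OF LB, of 2] GB by simp
    have ght: "g k \<in> hom (third_obj Z k) (G k)" "h k \<in> hom (G k) (third_obj Z k)" "t k \<in> hom (G k) (B (Suc k))"
      "h k \<cdot> g k = one (third_obj Z k)" "t k \<cdot> g k = \<zero> (third_obj Z k) (B (Suc k))" if k: "2 \<le> k" "k \<le> n" for k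
    proof -
      \<comment> \<open>Needed at k = 2, where \<open>h \<cdot> g\<close> factors through the zero
        object's own zero map yet has to be its identity.\<close>
      have "one (zob C) = \<zero> (zob C) (zob C)"
        by (rule to_zero_obj[OF is_zero_obj_zob one_hom]) simp
      then show "g k \<in> hom (third_obj Z k) (G k)" "h k \<in> hom (G k) (third_obj Z k)" "t k \<in> hom (G k) (B (Suc k))"
        "h k \<cdot> g k = one (third_obj Z k)" "t k \<cdot> g k = \<zero> (third_obj Z k) (B (Suc k))"
        unfolding third_obj[OF k] g_def h_def t_def using k b2 longD(1)[OF LG, of k] obj_cod[of "\<beta> 2"]
        by (auto simp: hom_iff)
    qed
    note ir = incl_retr[OF P ght]
    have ip: "i k \<in> hom (fst ?D k) (reduced_obj E G k) \<and> p k \<in> hom (reduced_obj E G k) (fst ?D k) \<and> p k \<cdot> i k = one (fst ?D k)"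
      if k: "1 \<le> k" "k \<le> n" for k
    proof (cases "k = 1")
      case True
      then show ?thesis using n3 le(1)[of 3, symmetric] by (simp add: i_def p_def Dseq_obj F1 hom_iff)
    next
      case False
      then have "2 \<le> k" using k by simp
      then show ?thesis using k ir[of k] by (simp add: i_def p_def Dseq_obj Fk)
    qed
    have first: "i 2 \<cdot> snd ?D 1 = reduced_map E e G \<gamma> \<theta> 1 \<cdot> i 1" "p 2 \<cdot> reduced_map E e G \<gamma> \<theta> 1 = snd ?D 1 \<cdot> p 1"
    proof -
      have S: "Suc 2 = 3" "Suc 3 = 4" by simp_all
      have i: "i 2 = incl (A 4) (B 3) (B 2) 2 (g 2) (?Q 2)" "p 2 = retr (A 4) (B 3) (B 2) 2 (\<beta> 2) (h 2) (?J 2)"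
        "i 1 = \<boxminus> (in1 (A 3) (B 2))" "p 1 = \<boxminus> (pr1 (A 3) (B 2))"
        by (simp_all add: i_def p_def t_def GB)
      have M: "reduced_map E e G \<gamma> \<theta> 1 = in1 (dsum (A 4) (B 3)) (B 2) \<cdot> \<boxminus>
          (in1 (A 4) (B 3) \<cdot> \<boxminus> (\<alpha> 3 \<cdot> pr1 (A 3) (B 2)) \<boxplus> in2 (A 4) (B 3) \<cdot> (\<phi> 3 \<cdot> pr1 (A 3) (B 2) \<boxplus> \<beta> 2 \<cdot> pr2 (A 3) (B 2)))
          \<boxplus> in2 (dsum (A 4) (B 3)) (B 2) \<cdot> pr2 (A 3) (B 2)"
        using \<theta>(3) by (simp add: reduced_map_def Ek GB) (simp add: Edefs reduced_map_def)
      have d: "snd ?D 1 = ?J 2 1 \<cdot> \<alpha> 3 \<boxplus> ?J 2 2 \<cdot> \<phi> 3" unfolding Dseq_first defs ..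
      have hom: "\<alpha> 3 \<in> hom (A 3) (A 4)" "\<phi> 3 \<in> hom (A 3) (B 3)" "\<beta> 2 \<in> hom (B 2) (B 3)"
        using longD(3)[OF LA, of 3] long_morD(1)[OF \<phi>(1), of 3] b2 GB by simp_all
      have zero: "is_zero_obj C (third_obj Z 2)" using is_zero_obj_zob by (simp add: third_obj_def)
      note gh = ght(1,2)[of 2, unfolded GB, OF order_refl n(4)]
      note fr = incl_retr_first[OF P[of 2, unfolded S] zero hom gh]
      show "i 2 \<cdot> snd ?D 1 = reduced_map E e G \<gamma> \<theta> 1 \<cdot> i 1" unfolding i M d by (rule fr(1))
      show "p 2 \<cdot> reduced_map E e G \<gamma> \<theta> 1 = snd ?D 1 \<cdot> p 1" unfolding i M d by (rule fr(2))
    qed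
    have middle: "i (Suc k) \<cdot> snd ?D k = reduced_map E e G \<gamma> \<theta> k \<cdot> i k \<and> p (Suc k) \<cdot> reduced_map E e G \<gamma> \<theta> k = snd ?D k \<cdot> p k
      \<and> snd ?D k \<in> hom (?P k) (?P (Suc k))"
      if k: "2 \<le> k" "k < n" for k
    proof -
      let ?A = "A (Suc (Suc k))" and ?A' = "A (Suc (Suc (Suc k)))" and ?B = "B (Suc k)" and ?B' = "B (Suc (Suc k))"
      let ?a = "\<alpha> (Suc (Suc k))" and ?b = "\<beta> (Suc k)" and ?f = "\<phi> (Suc (Suc k))" and ?t = "\<theta> (Suc k)"
      \<comment> \<open>This is the third diagonal entry of the map in D. It differs from \<gamma>_k
        only at k = 2, where its source is the zero object instead of C_2.\<close>
      define c where "c = (if k = 2 then \<zero> (zob C) (G (Suc k)) else \<gamma> k)"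
      obtain j where j: "k = j + 1" "1 \<le> j" by (rule that[of "k - 1"]) (use k in simp_all)
      have kj: "j + 1 = k" "j + 2 = Suc k" "j + 3 = Suc (Suc k)" using j by simp_all
      \<comment> \<open>\<open>Suc k\<close> is j + 2, so the sign used in \<psi> agrees with the
        one used in \<open>incl\<close> and \<open>retr\<close>.\<close>
      have sg: "sgnm C j = sgnm C (Suc k)" using j by (auto simp: sgnm_def fun_eq_iff)
      have ps: "\<psi> (2 * j - 1) = ?t \<cdot> in2 ?A ?B" "\<psi> (2 * j) = sgnm C (Suc k) (?t \<cdot> in1 ?A ?B)"
        using \<psi>[OF j(2), unfolded kj sg] by simp_all
      have gS: "fst Z (Suc k) = G (Suc k)" using k le(3)[of "Suc k"] by simp
      have psh: "\<psi> (2 * j) \<in> hom ?A (G (Suc k))" "\<psi> (2 * j - 1) \<in> hom ?B (G (Suc k))"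
        using \<psi>h[OF j(2), unfolded kj] by simp_all
      have cj: "(if 2 \<le> j then \<gamma> k else \<zero> (zob C) (G (Suc k))) = c" using j k by (simp add: c_def)
      have jn: "Suc j < n" using j k by simp
      have fh': "?f \<in> hom ?A ?B'" using long_morD(1)[OF \<phi>(1)] by simp
      note dm = Dseq_middle[OF XN YN ZN j(2) jn, of \<phi> \<psi>, folded defs, unfolded kj gS cj, OF fh' psh, unfolded ps]
      have topS: "third_obj Z (Suc k) = G (Suc k)" using k third_obj[of "Suc k"] by simp
      have hom: "?a \<in> hom ?A ?A'" "?b \<in> hom ?B ?B'" "\<gamma> k \<in> hom (G k) (G (Suc k))"
        using longD(3)[OF LA] longD(3)[OF LB] longD(3)[OF LG] k by simp_all
      have ch: "c \<in> hom (third_obj Z k) (G (Suc k))" using k hom(3) third_obj[of k] by (simp add: c_def zero_hom)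
      have th: "?t \<in> hom (dsum ?A ?B) (G (Suc k))" using \<theta>h[of "Suc k"] k by simp
      have gk [simp]: "obj (G k)" using longD(1)[OF LG, of k] k by simp
      have cg: "\<gamma> k \<cdot> g k = c" using hom(3) by (auto simp: c_def g_def hom_iff)
      \<comment> \<open>At k = 2 this says \<beta>_3 \<beta>_2 = 0; for larger k the map
        \<open>t k\<close> is zero.\<close>
      have bt: "?b \<cdot> t k = \<zero> (G k) ?B'"
      proof (cases "k = 2")
        case True
        then show ?thesis using ext_map_comp[OF YN, of 2, folded defs] GB by (simp add: t_def)
      qed (use hom(2) in \<open>simp add: t_def hom_iff\<close>)
      \<comment> \<open>At k = 2 the second square of \<theta>, namely \<theta>_3 e_2 = \<gamma>_2
        [0 1], is restricted to B_2. Since e_2 maps B_2 by \<beta>_2 into B_3, the B-component of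
        \<theta>_3 after \<beta>_2 equals \<gamma>_2.\<close>
      have ct: "?t \<cdot> in2 ?A ?B \<cdot> t k \<boxplus> c \<cdot> h k = \<gamma> k"
      proof (cases "k = 2")
        case True
        have h4: "\<alpha> 3 \<in> hom (A 3) (A 4)" "\<phi> 3 \<in> hom (A 3) (B 3)" "\<beta> 2 \<in> hom (B 2) (B 3)" "\<gamma> 2 \<in> hom (B 2) (G 3)"
          "\<theta> 3 \<in> hom (dsum (A 4) (B 3)) (G 3)" "obj (A 4)" "obj (B 3)"
          using longD(3)[OF LA, of 3] long_morD(1)[OF \<phi>(1), of 3] b2 GB hom(3) True \<theta>h[of 3]
            longD(1)[OF LA, of 4] longD(1)[OF LB, of 3] by simp_all
        have e2: "e 2 = in1 (A 4) (B 3) \<cdot> \<boxminus> (\<alpha> 3 \<cdot> pr1 (A 3) (B 2)) \<boxplus> in2 (A 4) (B 3) \<cdot> (\<phi> 3 \<cdot> pr1 (A 3) (B 2) \<boxplus> \<beta> 2 \<cdot> pr2 (A 3) (B 2))"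
          by (simp add: Edefs reduced_map_def)
        have "\<theta> 3 \<cdot> e 2 = \<gamma> 2 \<cdot> pr2 (A 3) (B 2)" using long_morD(2)[OF \<theta>(1), of 2] \<theta>(3) by simp
        then have "(\<theta> 3 \<cdot> e 2) \<cdot> in2 (A 3) (B 2) = (\<gamma> 2 \<cdot> pr2 (A 3) (B 2)) \<cdot> in2 (A 3) (B 2)" by (rule arg_cong)
        then have "\<theta> 3 \<cdot> in2 (A 4) (B 3) \<cdot> \<beta> 2 = \<gamma> 2" unfolding e2 using h4 by (simp add: hom_iff)
        moreover have "c \<cdot> h k = \<zero> (G 2) (G 3)" using True h4 obj_cod[of "\<gamma> 2"] by (simp add: c_def h_def hom_iff)
        ultimately show ?thesis using True h4 GB by (simp add: t_def hom_iff)
      next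
        case False
        then show ?thesis using hom(3) th by (simp add: t_def c_def h_def hom_iff)
      qed
      have M: "reduced_map E e G \<gamma> \<theta> k = in1 (dsum ?A' ?B') (G (Suc k)) \<cdot> \<boxminus>
          ((in1 ?A' ?B' \<cdot> \<boxminus> (?a \<cdot> pr1 ?A ?B) \<boxplus> in2 ?A' ?B' \<cdot> (?f \<cdot> pr1 ?A ?B \<boxplus> ?b \<cdot> pr2 ?A ?B)) \<cdot> pr1 (dsum ?A ?B) (G k))
          \<boxplus> in2 (dsum ?A' ?B') (G (Suc k)) \<cdot> (?t \<cdot> pr1 (dsum ?A ?B) (G k) \<boxplus> \<gamma> k \<cdot> pr2 (dsum ?A ?B) (G k))"
      proof -
        have "e (Suc k) = in1 ?A' ?B' \<cdot> \<boxminus> (?a \<cdot> pr1 ?A ?B) \<boxplus> in2 ?A' ?B' \<cdot> (?f \<cdot> pr1 ?A ?B \<boxplus> ?b \<cdot> pr2 ?A ?B)"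
          unfolding Edefs reduced_map_def using k by simp
        moreover have "reduced_map E e G \<gamma> \<theta> k = in1 (E (Suc (Suc k))) (G (Suc k)) \<cdot> \<boxminus> (e (Suc k) \<cdot> pr1 (E (Suc k)) (G k))
          \<boxplus> in2 (E (Suc (Suc k))) (G (Suc k)) \<cdot> (?t \<cdot> pr1 (E (Suc k)) (G k) \<boxplus> \<gamma> k \<cdot> pr2 (E (Suc k)) (G k))"
          unfolding reduced_map_def using k by simp
        moreover have "E (Suc k) = dsum ?A ?B" "E (Suc (Suc k)) = dsum ?A' ?B'" using k by (simp_all add: Ek)
        ultimately show ?thesis by simp
      qed
      have k': "k \<le> n" using k by simp
      note gk' = ght[OF k(1) k']
      note mid = incl_retr_middle[OF P[of k] P[of "Suc k", unfolded topS] gk'(1-3) hom(1,2,3) ch fh' th dm(1) gk'(4,5) cg bt ct dm(2-4)]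
      have ii: "i k = incl ?A ?B (G k) k (g k) (?Q k)" "p k = retr ?A ?B (G k) k (t k) (h k) (?J k)"
        "i (Suc k) = incl ?A' ?B' (G (Suc k)) (Suc k) (one (G (Suc k))) (?Q (Suc k))"
        "p (Suc k) = retr ?A' ?B' (G (Suc k)) (Suc k) (\<zero> (G (Suc k)) ?B') (one (G (Suc k))) (?J (Suc k))"
        using k by (simp_all add: i_def p_def g_def h_def t_def)
      show ?thesis unfolding ii M by (intro conjI mid dm(1))
    qed
    have topn: "third_obj Z n = G n" using third_obj[of n] n by simp
    have last: "Sm (i 1) \<cdot> snd ?D n = reduced_last E e G (snd Z n) \<cdot> i n" "Sm (p 1) \<cdot> reduced_last E e G (snd Z n) = snd ?D n \<cdot> p n"
    proof -
      have i: "i 1 = \<boxminus> (in1 (A 3) (B 2))" "p 1 = \<boxminus> (pr1 (A 3) (B 2))"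
        "i n = incl (A (Suc (Suc n))) (B (Suc n)) (G n) n (one (G n)) (?Q n)"
        "p n = retr (A (Suc (Suc n))) (B (Suc n)) (G n) n (\<zero> (G n) (B (Suc n))) (one (G n)) (?J n)"
        using n by (simp_all add: i_def p_def g_def h_def t_def)
      have W: "reduced_last E e G (snd Z n) = Sm (in1 (A 3) (B 2) \<cdot> \<boxminus> (\<alpha> 2) \<boxplus> in2 (A 3) (B 2) \<cdot> f) \<cdot> snd Z n
          \<cdot> pr2 (dsum (A (Suc (Suc n))) (B (Suc n))) (G n)"
        unfolding reduced_last_def e1[symmetric] using n by (simp add: Ek)
      have d: "snd ?D n = Sm (\<alpha> 2) \<cdot> snd Z n \<cdot> ?Q n 3" unfolding Dseq_last using n lt(1)[of 2] by simp
      have zh: "snd Z n \<in> hom (G n) (S (A 2))" using longD(4)[OF LG] GA by simp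
      \<comment> \<open>Since f = \<gamma>_1, this is the vanishing of the closing map of Z followed
        by the shift of its first map.\<close>
      have fz: "Sm f \<cdot> snd Z n = \<zero> (G n) (S (B 2))" using comp_last[OF ZN] eqs n by (simp add: le)
      note la = incl_retr_last[OF P[of n, unfolded topn] a2 fh zh fz, of n]
      show "Sm (i 1) \<cdot> snd ?D n = reduced_last E e G (snd Z n) \<cdot> i n" unfolding i W d by (rule la(1))
      show "Sm (p 1) \<cdot> reduced_last E e G (snd Z n) = snd ?D n \<cdot> p n" unfolding i W d by (rule la(2))
    qed
    have sq: "i (Suc k) \<cdot> snd ?D k = reduced_map E e G \<gamma> \<theta> k \<cdot> i k \<and> p (Suc k) \<cdot> reduced_map E e G \<gamma> \<theta> k = snd ?D k \<cdot> p k"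
      if k: "1 \<le> k" "k < n" for k
    proof (cases "k = 1")
      case True
      then show ?thesis using first by simp
    next
      case False
      then show ?thesis using middle[of k] k by simp
    qed
    show ?thesis
    proof (rule summand[OF _ \<theta>(4), of _ i p])
      show "is_seq C S n ?D"
        unfolding is_seq_def Let_def
      proof (intro conjI ballI)
        show "obj (fst ?D k)" if "k \<in> {1..n}" for k
          using ip[of k] hom_obj[of "i k" "fst ?D k" "reduced_obj E G k"] that by simp
        show "snd ?D k \<in> hom (fst ?D k) (fst ?D (Suc k))" if k: "k \<in> {1..<n}" for k
        proof (cases "k = 1")
          case True
          have "\<alpha> 3 \<in> hom (A 3) (A 4)" "\<phi> 3 \<in> hom (A 3) (B 3)"
            using longD(3)[OF LA, of 3] long_morD(1)[OF \<phi>(1), of 3] by simp_all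
          moreover have "?J 2 1 \<in> hom (A 4) (?P 2)" "?J 2 2 \<in> hom (B 3) (?P 2)"
            using P[of 2] unfolding is_dsum_3_iff by (simp_all add: three_def)
          ultimately show ?thesis using True le(1)[of 3] n3
            by (simp add: Dseq_obj Dseq_first hom_iff flip: defs)
        next
          case False
          then show ?thesis using middle[of k] k by (simp add: Dseq_obj)
        qed
        have "?Q n 3 \<in> hom (?P n) (G n)" using P[of n] unfolding is_dsum_3_iff by (simp add: three_def topn)
        then show "snd ?D n \<in> hom (fst ?D n) (S (fst ?D 1))"
          using longD(4)[OF LG] GA a2 n n3 lt(1)[of 2] le(1)[of 3] by (simp add: Dseq_obj Dseq_last hom_iff)
      qed
      show "is_seqmor C Sm n ?D ?F i" "is_seqmor C Sm n ?F ?D p"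
        unfolding is_seqmor_def Let_def using ip sq last by simp_all
    qed (use ip in simp)
  qed
  moreover have "\<psi> (2 * k - 1) \<in> hom (fst Y (k + 2)) (fst Z (k + 2)) \<and>
      (k + 3 \<le> n \<longrightarrow> \<psi> (2 * k) \<in> hom (fst X (k + 3)) (fst Z (k + 2)))" if "k \<in> {1..n-2}" for k
    using \<psi>h[of k] le(1)[of "k + 3"] le(2,3)[of "k + 2"] that by auto
  ultimately show "\<exists>\<phi> \<psi>. \<phi> 1 = one (fst X 1) \<and> \<phi> 2 = f \<and> is_seqmor C Sm n X Y \<phi> \<and>
        (\<forall>k\<in>{1..n-2}. \<psi> (2 * k - 1) \<in> hom (fst Y (k + 2)) (fst Z (k + 2)) \<and>
                       (k + 3 \<le> n \<longrightarrow> \<psi> (2 * k) \<in> hom (fst X (k + 3)) (fst Z (k + 2)))) \<and>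
        snd Z n \<cdot> \<psi> (2 * n - 5) = Sm (snd X 1) \<cdot> snd Y n \<and>
        Dseq C S Sm n X Y Z \<phi> \<psi> \<in> N"
    using \<phi>(2,3) mor last n le(1)[of 1] by (intro exI[of _ \<phi>] exI[of _ \<psi>]) simp
qed

end

theorem theorem4p2:
  fixes C :: "('o,'m) precat" and S :: "'o \<Rightarrow> 'o" and Sm :: "'m \<Rightarrow> 'm"
    and n :: nat and N :: "('o,'m) seq set"
  assumes "additive_cat C"
    and "automorphism C S Sm"
    and "3 \<le> n"
    and "\<forall>X\<in>N. is_seq C S n X"
    and "N1 C S Sm n N" and "N2 C S Sm n N" and "N3 C S Sm n N" and "N4 C S Sm n N"
  shows "N4star C S Sm n N"
proof -
  interpret n_angulated C S Sm n N
    by unfold_locales (use assms in blast)+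
  show ?thesis by (rule N4star)
qed

end
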